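(* The function $\Delta:(0,1]\to\mathbb{R}$ defined in the context satisfies: (i) $\Delta(\varepsilon)=2\varepsilon-1$ for $\frac{11}{16}\le\varepsilon\le1$, and $\Delta(\varepsilon)\ge2\varepsilon-1$ for $\frac12\le\varepsilon\le\frac{11}{16}$; (ii) $\Delta(\varepsilon)\ge 0.591389\,\varepsilon^2$ for all $0<\varepsilon\le1$; (iii) $\Delta(\varepsilon)\ge 0.5546\,\varepsilon^2+0.088079\,\varepsilon^3$ for all $0<\varepsilon\le1$; (iv) $\Delta(\varepsilon)\le\frac{96}{121}\varepsilon^2<0.7934\,\varepsilon^2$ for $0<\varepsilon\le\frac{11}{16}$; (v) $\Delta(\varepsilon)\le\frac{\pi\varepsilon^2}{(1+\sqrt{1-\varepsilon})^2}=\frac{\pi}{4}\varepsilon^2+O(\varepsilon^3)$ for all $0<\varepsilon\le1$.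
   Context: Let $\lambda$ denote Lebesgue measure on $\mathbb{R}$. A set $C\subseteq\mathbb{R}$ is symmetric if there is a number $c$ (its center) such that, for all $x$, $c+x\in C$ if and only if $c-x\in C$. For a measurable set $A$ of reals put $D(A):=\sup\{\lambda(C): C\subseteq A,\ C \text{ measurable and symmetric}\}$. Define $\Delta(\varepsilon):=\inf\{D(A): A\subseteq[0,1)\text{ measurable},\ \lambda(A)=\varepsilon\}$. Equivalently, $\Delta(\varepsilon)$ is the supremum of those $\delta$ such that every measurable subset of $[0,1)$ of measure $\varepsilon$ contains a symmetric subset of measure $\delta$. *)

theory Defs
  imports "HOL-Analysis.Analysis" "HOL-Library.Landau_Symbols"
begin

definition symmetric_set :: "real set \<Rightarrow> bool" where
  "symmetric_set C \<longleftrightarrow> (\<exists>c. \<forall>x. c + x \<in> C \<longleftrightarrow> c - x \<in> C)"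

(* Extended values, since D A = \<infinity> for e.g. A = UNIV. *)
definition D :: "real set \<Rightarrow> ennreal" where
  "D A = Sup {emeasure lebesgue C | C. C \<subseteq> A \<and> C \<in> sets lebesgue \<and> symmetric_set C}"

(* The conversion to real loses nothing for 0 \<le> \<epsilon> \<le> 1, where the infimum is finite:
   see ennreal_Delta. *)
definition Delta :: "real \<Rightarrow> real" where
  "Delta \<epsilon> = enn2real (Inf {D A | A. A \<subseteq> {0..<1} \<and> A \<in> sets lebesgue
                                      \<and> emeasure lebesgue A = ennreal \<epsilon>})"

lemma D_le_emeasure:
  assumes "A \<in> sets lebesgue"
  shows "D A \<le> emeasure lebesgue A"
  unfolding D_def using assms by (blast intro: Sup_least emeasure_mono)

lemma ennreal_Delta:
  assumes "0 \<le> \<epsilon>" "\<epsilon> \<le> 1"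
  shows "ennreal (Delta \<epsilon>) = Inf {D A | A. A \<subseteq> {0..<1} \<and> A \<in> sets lebesgue
                                      \<and> emeasure lebesgue A = ennreal \<epsilon>}"
    (is "_ = Inf ?S")
proof -
  have A: "{0..<\<epsilon>} \<in> sets lebesgue" "emeasure lebesgue {0..<\<epsilon>} = ennreal \<epsilon>"
    using assms by auto
  have "D {0..<\<epsilon>} \<in> ?S"
    using assms A by (intro CollectI exI[of _ "{0..<\<epsilon>}"]) auto
  then have "Inf ?S \<le> D {0..<\<epsilon>}"
    by (rule Inf_lower)
  also have "\<dots> \<le> ennreal \<epsilon>"
    using D_le_emeasure[OF A(1)] A(2) by simp
  finally have "Inf ?S < top"
    using ennreal_less_top le_less_trans by blast
  then show ?thesis
    unfolding Delta_def by (rule ennreal_enn2real)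
qed

end

theory Submission
  imports Defs
begin

text \<open>
  A symmetric subset of \<open>A\<close> with center \<open>c / 2\<close> lies in the overlap of \<open>A\<close> with its
  reflection \<open>c - A\<close>, and that overlap is itself symmetric. Hence \<open>D A\<close> is the supremum over
  \<open>c\<close> of the measure of \<open>A \<inter> (c - A)\<close>, which is the supremum of the autoconvolution of the
  indicator of \<open>A\<close>, and the theorem is about how small such a supremum can be.

  Lower bounds. Inclusion-exclusion for \<open>A\<close> and \<open>1 - A\<close> inside the unit interval gives
  \<open>2\<epsilon> - 1\<close>. For the quadratic bound let \<open>d\<close> bound all reflected overlaps and let \<open>G z\<close> be the
  measure of \<open>A \<inter> (A - z)\<close>. The exchange identity \<open>nn_integral_corr_mult\<close> says that \<open>G\<close> has
  the same \<open>L\<^sup>2\<close> norm as the autoconvolution, so \<open>\<integral>G\<^sup>2 \<le> d \<epsilon>\<^sup>2\<close>: if \<open>d\<close> is close to \<open>\<epsilon>\<^sup>2 / 2\<close>,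
  then \<open>G\<close> is nearly constant on \<open>[-1, 1]\<close>, and its integral against the triangle
  \<open>T z = max 0 (h - \<bar>z\<bar>)\<close> is not much larger than that of a constant. On the other hand, let
  \<open>w t\<close> be the measure of \<open>A\<close> in the window of length \<open>h\<close> around \<open>t\<close>, plus the same for the
  mirror image of \<open>A\<close>. The function \<open>w\<close> has integral \<open>2 h \<epsilon>\<close> and lives on an interval of length
  \<open>1 + h\<close>, so \<open>\<integral>w\<^sup>2 \<ge> 4 h\<^sup>2 \<epsilon>\<^sup>2 / (1 + h)\<close>; expanding the square, \<open>\<integral>w\<^sup>2\<close> is \<open>2 \<integral>T G\<close> plus
  a cross term, and this cross term only sees reflected overlaps, so it is at most \<open>2 h\<^sup>2 d\<close>.
  The two estimates for \<open>\<integral>T G\<close> are compatible only if \<open>d \<ge> 0.61 \<epsilon>\<^sup>2\<close>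
  (\<open>reflected_overlap_ge\<close>). This exceeds the claimed quadratic bound, and the cubic one for
  \<open>\<epsilon> \<le> 0.62\<close>; beyond that point \<open>2\<epsilon> - 1\<close> exceeds the cubic bound.

  Upper bounds. For a step function \<open>f\<close> with values in \<open>[0, 1]\<close>, the extremal function at
  \<open>\<integral>f\<close> is at most the supremum of the autoconvolution of \<open>f\<close> (\<open>Delta_step_le\<close>). Indeed, cut
  the unit interval into many small cells and keep each cell independently with the probability
  prescribed by \<open>f\<close>; by exponential moment bounds the overlaps of the resulting set with its
  reflections are uniformly close to the autoconvolution of \<open>f\<close>. The expected exponential
  moments are polynomials of degree at most one in each single probability, so the
  probabilities can be rounded to 0 or 1 one at a time without increasing them, and no
  probability space is required.

  Two densities then suffice. The step function with values 1, 1, 1, 0, 1, 1/2, 0, 1 on the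
  eighths of the interval has integral \<open>11/16\<close> and autoconvolution at most \<open>3/8\<close>; scaled down it
  gives \<open>96/121 \<epsilon>\<^sup>2\<close>, and adding points to it gives \<open>2\<epsilon> - 1\<close> from \<open>11/16\<close> on. The density
  \<open>min 1 (b / sqrt x)\<close> with \<open>b = 1 - sqrt (1 - \<epsilon>)\<close> has integral \<open>\<epsilon>\<close>, and its autoconvolution
  is at most \<open>\<pi> b\<^sup>2\<close> because \<open>1 / sqrt (x (c - x))\<close> has integral \<open>\<pi>\<close> over \<open>[0, c]\<close>, whatever
  \<open>c\<close> is.
\<close>

section \<open>Overlaps with reflections\<close>

definition reflect :: "real \<Rightarrow> real set \<Rightarrow> real set" where
  "reflect c A = {x. c - x \<in> A}"

lemma in_reflect [simp]: "x \<in> reflect c A \<longleftrightarrow> c - x \<in> A"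
  by (simp add: reflect_def)

lemma reflect_sets [measurable (raw), simp]:
  assumes "A \<in> sets lebesgue"
  shows "reflect c A \<in> sets lebesgue"
proof -
  have "(\<lambda>x::real. c + (\<Sum>j\<in>Basis. (- 1 * (x \<bullet> j)) *\<^sub>R j)) \<in> lebesgue \<rightarrow>\<^sub>M lebesgue"
    by (rule lebesgue_affine_measurable) auto
  then have "(\<lambda>x::real. c - x) \<in> lebesgue \<rightarrow>\<^sub>M lebesgue" by simp
  from measurable_sets[OF this assms] show ?thesis
    by (simp add: reflect_def vimage_def)
qed

lemma emeasure_reflect [simp]:
  assumes [measurable]: "A \<in> sets lebesgue"
  shows "emeasure lebesgue (reflect c A) = emeasure lebesgue A"
proof -
  have "emeasure lebesgue A = (\<integral>\<^sup>+x. indicator A x \<partial>lebesgue)" by simp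
  also have "\<dots> = (\<integral>\<^sup>+x. indicator A (c + (-1) * x) \<partial>lebesgue)"
    by (subst nn_integral_real_affine_lebesgue[of _ "-1" c]) auto
  also have "\<dots> = (\<integral>\<^sup>+x. indicator (reflect c A) x \<partial>lebesgue)"
    by (intro nn_integral_cong) (auto simp: indicator_def)
  also have "\<dots> = emeasure lebesgue (reflect c A)" by simp
  finally show ?thesis by simp
qed

lemma symmetric_Int_reflect: "symmetric_set (A \<inter> reflect c A)"
  unfolding symmetric_set_def by (rule exI[of _ "c / 2"]) auto

lemma symmetric_subset_Int_reflect:
  assumes "C \<subseteq> A" "symmetric_set C"
  shows "\<exists>c. C \<subseteq> A \<inter> reflect c A"
proof -
  obtain c where c: "\<And>x. c + x \<in> C \<longleftrightarrow> c - x \<in> C"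
    using assms(2) unfolding symmetric_set_def by blast
  have "2 * c - x \<in> C" if "x \<in> C" for x
    using c[of "c - x"] that by simp
  then show ?thesis using assms(1) by (intro exI[of _ "2 * c"]) (auto simp: subset_iff)
qed

text \<open>
  Optimising over symmetric subsets thus becomes optimising over a single real parameter.
\<close>
lemma D_eq_SUP_reflect:
  assumes "A \<in> sets lebesgue"
  shows "D A = (SUP c. emeasure lebesgue (A \<inter> reflect c A))"
proof (rule antisym)
  show "D A \<le> (SUP c. emeasure lebesgue (A \<inter> reflect c A))"
    unfolding D_def
  proof (rule Sup_least, clarify)
    fix C assume C: "C \<subseteq> A" "symmetric_set C"
    obtain c where "C \<subseteq> A \<inter> reflect c A" using symmetric_subset_Int_reflect[OF C] by blast
    then show "emeasure lebesgue C \<le> (SUP c. emeasure lebesgue (A \<inter> reflect c A))"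
      using assms by (intro SUP_upper2[of c] emeasure_mono) auto
  qed
  show "(SUP c. emeasure lebesgue (A \<inter> reflect c A)) \<le> D A"
    unfolding D_def using assms symmetric_Int_reflect
    by (intro SUP_least Sup_upper CollectI exI[of _ "A \<inter> reflect _ A"]) auto
qed

section \<open>Lower bounds\<close>

lemma Delta_geI:
  assumes \<epsilon>: "0 \<le> \<epsilon>" "\<epsilon> \<le> 1"
    and d: "\<And>A. A \<subseteq> {0..<1} \<Longrightarrow> A \<in> sets lebesgue \<Longrightarrow> emeasure lebesgue A = ennreal \<epsilon>
        \<Longrightarrow> ennreal d \<le> D A"
  shows "d \<le> Delta \<epsilon>"
proof -
  have "ennreal d \<le> ennreal (Delta \<epsilon>)"
    unfolding ennreal_Delta[OF \<epsilon>] using d by (intro Inf_greatest) blast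
  moreover have "0 \<le> Delta \<epsilon>" unfolding Delta_def by simp
  ultimately show ?thesis by (simp add: ennreal_le_iff)
qed

text \<open>
  The sets \<open>A\<close> and \<open>1 - A\<close> both have measure \<open>\<epsilon>\<close> inside an interval of length 1.
\<close>
lemma Delta_ge_two_mult:
  assumes \<epsilon>: "1 / 2 \<le> \<epsilon>" "\<epsilon> \<le> 1"
  shows "2 * \<epsilon> - 1 \<le> Delta \<epsilon>"
proof (rule Delta_geI)
  fix A :: "real set"
  assume A: "A \<subseteq> {0..<1}" "A \<in> sets lebesgue" "emeasure lebesgue A = ennreal \<epsilon>"
  have "2 * ennreal \<epsilon> = emeasure lebesgue A + emeasure lebesgue (reflect 1 A)"
    by (simp only: emeasure_reflect[OF A(2)] A(3) mult_2)
  also have "\<dots> = emeasure lebesgue (A \<inter> reflect 1 A) + emeasure lebesgue (A \<union> reflect 1 A)"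
    using A(2) by (subst (2) add.commute, intro emeasure_Un_Int) auto
  also have "\<dots> \<le> D A + ennreal 1"
  proof (rule add_mono)
    show "emeasure lebesgue (A \<inter> reflect 1 A) \<le> D A"
      unfolding D_eq_SUP_reflect[OF A(2)] by (rule SUP_upper) simp
    have "emeasure lebesgue (A \<union> reflect 1 A) \<le> emeasure lebesgue {0..1::real}"
      using A(1) by (intro emeasure_mono) auto
    then show "emeasure lebesgue (A \<union> reflect 1 A) \<le> ennreal 1" by simp
  qed
  finally have "ennreal (2 * \<epsilon>) \<le> D A + ennreal 1"
    using \<epsilon> by (simp add: ennreal_mult)
  then have "ennreal (2 * \<epsilon>) - ennreal 1 \<le> D A"
    by (simp add: ennreal_minus_le_iff add.commute)
  then show "ennreal (2 * \<epsilon> - 1) \<le> D A"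
    by (simp only: ennreal_minus[OF zero_le_one])
qed (use \<epsilon> in auto)

text \<open>
  For indicators this is the measure of the overlap of one set with a translate of the other.
  Values in the extended nonnegative reals make every use of Tonelli's theorem unconditional.
\<close>
definition corr :: "(real \<Rightarrow> ennreal) \<Rightarrow> (real \<Rightarrow> ennreal) \<Rightarrow> real \<Rightarrow> ennreal" where
  "corr f g z = (\<integral>\<^sup>+x. f x * g (x + z) \<partial>lborel)"

lemma corr_measurable [measurable (raw)]:
  assumes [measurable]: "f \<in> borel_measurable borel" "g \<in> borel_measurable borel"
  shows "corr f g \<in> borel_measurable borel"
  unfolding corr_def[abs_def] by measurable

lemma nn_integral_shift:
  fixes f :: "real \<Rightarrow> ennreal"
  assumes [measurable]: "f \<in> borel_measurable borel"
  shows "(\<integral>\<^sup>+x. f (t + x) \<partial>lborel) = (\<integral>\<^sup>+x. f x \<partial>lborel)"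
  using nn_integral_real_affine[of f 1 t] by simp

lemma nn_integral_reflect:
  fixes f :: "real \<Rightarrow> ennreal"
  assumes [measurable]: "f \<in> borel_measurable borel"
  shows "(\<integral>\<^sup>+x. f (t - x) \<partial>lborel) = (\<integral>\<^sup>+x. f x \<partial>lborel)"
  using nn_integral_real_affine[of f "-1" t] by simp

lemma nn_integral_corr:
  assumes [measurable]: "f \<in> borel_measurable borel" "g \<in> borel_measurable borel"
  shows "(\<integral>\<^sup>+z. corr f g z \<partial>lborel) = (\<integral>\<^sup>+x. f x \<partial>lborel) * (\<integral>\<^sup>+x. g x \<partial>lborel)"
proof -
  have "(\<integral>\<^sup>+z. corr f g z \<partial>lborel) = (\<integral>\<^sup>+x. \<integral>\<^sup>+z. f x * g (x + z) \<partial>lborel \<partial>lborel)"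
    unfolding corr_def by (rule lborel_pair.Fubini') measurable
  also have "\<dots> = (\<integral>\<^sup>+x. f x * (\<integral>\<^sup>+z. g z \<partial>lborel) \<partial>lborel)"
    by (simp add: nn_integral_cmult nn_integral_shift)
  also have "\<dots> = (\<integral>\<^sup>+x. f x \<partial>lborel) * (\<integral>\<^sup>+x. g x \<partial>lborel)"
    by (simp add: nn_integral_multc)
  finally show ?thesis .
qed

text \<open>
  Both sides integrate \<open>f x * g (x + z) * u (x + y) * v (x + y + z)\<close> over all \<open>x, y, z\<close>; the
  four points form a parallelogram, and exchanging \<open>g\<close> with \<open>u\<close> is exchanging its two
  directions \<open>y\<close> and \<open>z\<close>.
\<close>
lemma nn_integral_corr_mult:
  assumes [measurable]: "f \<in> borel_measurable borel" "g \<in> borel_measurable borel"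
    "u \<in> borel_measurable borel" "v \<in> borel_measurable borel"
  shows "(\<integral>\<^sup>+z. corr f g z * corr u v z \<partial>lborel) = (\<integral>\<^sup>+z. corr f u z * corr g v z \<partial>lborel)"
proof -
  have expand: "corr p q z * corr r s z
      = (\<integral>\<^sup>+x. \<integral>\<^sup>+y. p x * q (x + z) * (r (x + y) * s (x + y + z)) \<partial>lborel \<partial>lborel)"
    if [measurable]: "p \<in> borel_measurable borel" "q \<in> borel_measurable borel"
      "r \<in> borel_measurable borel" "s \<in> borel_measurable borel" for p q r s z
  proof -
    have "corr p q z * corr r s z = (\<integral>\<^sup>+x. p x * q (x + z) * corr r s z \<partial>lborel)"
      unfolding corr_def[of p] by (rule nn_integral_multc[symmetric]) measurable
    also have "\<dots> = (\<integral>\<^sup>+x. p x * q (x + z) * (\<integral>\<^sup>+y. r (x + y) * s (x + y + z) \<partial>lborel) \<partial>lborel)"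
      unfolding corr_def[of r] using nn_integral_shift[of "\<lambda>y. r y * s (y + z)"] by simp
    also have "\<dots> = (\<integral>\<^sup>+x. \<integral>\<^sup>+y. p x * q (x + z) * (r (x + y) * s (x + y + z)) \<partial>lborel \<partial>lborel)"
      by (simp add: nn_integral_cmult)
    finally show ?thesis .
  qed
  let ?K = "\<lambda>x y z. f x * g (x + z) * (u (x + y) * v (x + y + z))"
  have "(\<integral>\<^sup>+z. corr f g z * corr u v z \<partial>lborel)
      = (\<integral>\<^sup>+z. \<integral>\<^sup>+x. \<integral>\<^sup>+y. ?K x y z \<partial>lborel \<partial>lborel \<partial>lborel)"
    by (simp add: expand)
  also have "\<dots> = (\<integral>\<^sup>+x. \<integral>\<^sup>+z. \<integral>\<^sup>+y. ?K x y z \<partial>lborel \<partial>lborel \<partial>lborel)"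
    by (rule lborel_pair.Fubini') measurable
  also have "\<dots> = (\<integral>\<^sup>+x. \<integral>\<^sup>+y. \<integral>\<^sup>+z. ?K x y z \<partial>lborel \<partial>lborel \<partial>lborel)"
    by (intro nn_integral_cong lborel_pair.Fubini') measurable
  also have "\<dots> = (\<integral>\<^sup>+y. \<integral>\<^sup>+x. \<integral>\<^sup>+z. ?K x y z \<partial>lborel \<partial>lborel \<partial>lborel)"
    by (rule lborel_pair.Fubini') measurable
  also have "\<dots> = (\<integral>\<^sup>+z. corr f u z * corr g v z \<partial>lborel)"
    by (simp add: expand ac_simps)
  finally show ?thesis .
qed

lemma corr_window:
  fixes h z :: real
  assumes "0 \<le> h"
  defines "\<psi> \<equiv> indicator {- (h / 2)..h / 2}"
  shows "corr \<psi> \<psi> z = ennreal (max 0 (h - \<bar>z\<bar>))"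
proof -
  have "corr \<psi> \<psi> z = (\<integral>\<^sup>+x. indicator {max (- (h / 2)) (- (h / 2) - z)..min (h / 2) (h / 2 - z)} x \<partial>lborel)"
    unfolding corr_def \<psi>_def by (intro nn_integral_cong) (auto simp: indicator_def)
  also have "\<dots> = ennreal (max 0 (h - \<bar>z\<bar>))"
    using assms(1) by (auto simp: emeasure_lborel_Icc_eq max_def min_def abs_if intro!: arg_cong[where f = ennreal])
  finally show ?thesis .
qed

lemma nn_integral_triangle_square_le:
  fixes h :: real
  assumes h: "0 \<le> h"
  shows "(\<integral>\<^sup>+z. (ennreal (max 0 (h - \<bar>z\<bar>)))\<^sup>2 \<partial>lborel) \<le> ennreal (2 * h ^ 3 / 3)"
proof -
  have left: "(\<integral>\<^sup>+z. ennreal ((h + z)\<^sup>2) * indicator {- h..0} z \<partial>lborel) = ennreal (h ^ 3 / 3)"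
    using h by (subst nn_integral_FTC_Icc[where F = "\<lambda>z. (h + z) ^ 3 / 3"])
      (auto intro!: derivative_eq_intros)
  have right: "(\<integral>\<^sup>+z. ennreal ((h - z)\<^sup>2) * indicator {0..h} z \<partial>lborel) = ennreal (h ^ 3 / 3)"
    using h by (subst nn_integral_FTC_Icc[where F = "\<lambda>z. - ((h - z) ^ 3 / 3)"])
      (auto intro!: derivative_eq_intros)
  have "(\<integral>\<^sup>+z. (ennreal (max 0 (h - \<bar>z\<bar>)))\<^sup>2 \<partial>lborel)
      \<le> (\<integral>\<^sup>+z. ennreal ((h + z)\<^sup>2) * indicator {- h..0} z + ennreal ((h - z)\<^sup>2) * indicator {0..h} z \<partial>lborel)"
    by (intro nn_integral_mono) (auto simp: ennreal_power max_def abs_if indicator_def)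
  also have "\<dots> = ennreal (2 * h ^ 3 / 3)"
    using h by (subst nn_integral_add) (auto simp: left right ennreal_plus[symmetric] simp del: ennreal_plus)
  finally show ?thesis .
qed

text \<open>
  This replaces the Cauchy-Schwarz inequality below: integrated with the optimal multiple of one
  factor it gives the same bound, and it involves neither subtraction nor integrability.
\<close>
lemma two_mult_le_sum_squares_ennreal: "2 * (x * y) \<le> x\<^sup>2 + (y\<^sup>2 :: ennreal)"
proof (cases x; cases y)
  fix r s :: real assume "x = ennreal r" "0 \<le> r" "y = ennreal s" "0 \<le> s"
  then show ?thesis
    using sum_squares_bound[of r s]
    by (simp add: ennreal_power ennreal_mult[symmetric] ennreal_plus[symmetric] ennreal_numeral[symmetric]
        mult.assoc del: ennreal_plus ennreal_numeral)
qed (auto simp: power2_eq_square ennreal_mult_top ennreal_top_mult)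

text \<open>
  Upper and lower estimates of the integral of \<open>T G\<close>, as described at the beginning of the
  theory, combined so that this integral cancels. The parameters \<open>\<beta>\<close> and \<open>c\<close> come from the upper
  estimate \<open>2 (\<beta> T + c) G \<le> (\<beta> T + c)\<^sup>2 + G\<^sup>2\<close> on \<open>[-1, 1]\<close>; it is sharp where \<open>G = \<beta> T + c\<close>.
\<close>
lemma reflected_overlap_bound:
  fixes A :: "real set" and \<epsilon> d h \<beta> c :: real
  assumes [measurable]: "A \<in> sets borel" and A: "A \<subseteq> {0..<1}"
    and \<epsilon>: "emeasure lborel A = ennreal \<epsilon>" "0 \<le> \<epsilon>"
    and d: "\<And>t. emeasure lborel (A \<inter> reflect t A) \<le> ennreal d" "0 \<le> d"
    and h: "0 \<le> h" and bc: "0 < \<beta>" "0 \<le> c"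
  shows "4 * \<beta> * h\<^sup>2 * \<epsilon>\<^sup>2 / (1 + h) - 2 * \<beta> * h\<^sup>2 * d
      \<le> \<beta>\<^sup>2 * (2 * h ^ 3 / 3) + 2 * c * \<beta> * h\<^sup>2 + 2 * c\<^sup>2 - 2 * c * \<epsilon>\<^sup>2 + d * \<epsilon>\<^sup>2"
proof -
  define a :: "real \<Rightarrow> ennreal" where "a = indicator A"
  define b :: "real \<Rightarrow> ennreal" where "b x = a (1 - x)" for x
  define \<psi> :: "real \<Rightarrow> ennreal" where "\<psi> = indicator {- (h / 2)..h / 2}"
  define T where "T = corr \<psi> \<psi>"
  define G where "G = corr a a"
  define \<kappa> where "\<kappa> = 2 * h * \<epsilon> / (1 + h)"
  \<comment> \<open>\<open>\<kappa>\<close> is the mean of the window function \<open>w\<close> below over an interval of length \<open>1 + h\<close>.\<close>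
  have \<kappa>: "0 \<le> \<kappa>" using h \<epsilon>(2) by (simp add: \<kappa>_def)
  have [measurable]: "a \<in> borel_measurable borel" "\<psi> \<in> borel_measurable borel"
    unfolding a_def \<psi>_def by measurable
  have [measurable]: "b \<in> borel_measurable borel"
    unfolding b_def[abs_def] by measurable
  have [measurable]: "T \<in> borel_measurable borel" "G \<in> borel_measurable borel"
    unfolding T_def G_def by measurable
  have int_a: "(\<integral>\<^sup>+x. a x \<partial>lborel) = ennreal \<epsilon>" using \<epsilon> by (simp add: a_def)
  have int_b: "(\<integral>\<^sup>+x. b x \<partial>lborel) = ennreal \<epsilon>"
    unfolding b_def using int_a by (simp add: nn_integral_reflect)
  have int_\<psi>: "(\<integral>\<^sup>+x. \<psi> x \<partial>lborel) = ennreal h" using h by (simp add: \<psi>_def)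
  have T: "T z = ennreal (max 0 (h - \<bar>z\<bar>))" for z
    unfolding T_def \<psi>_def by (rule corr_window[OF h])
  have int_T: "(\<integral>\<^sup>+z. T z \<partial>lborel) = ennreal (h\<^sup>2)"
    unfolding T_def using h by (simp add: nn_integral_corr int_\<psi> power2_eq_square ennreal_mult)
  have int_T2: "(\<integral>\<^sup>+z. (T z)\<^sup>2 \<partial>lborel) \<le> ennreal (2 * h ^ 3 / 3)"
    unfolding T by (rule nn_integral_triangle_square_le[OF h])
  have int_G: "(\<integral>\<^sup>+z. G z \<partial>lborel) = ennreal (\<epsilon>\<^sup>2)"
    unfolding G_def using \<epsilon>(2) by (simp add: nn_integral_corr int_a power2_eq_square ennreal_mult)
  \<comment> \<open>Correlating \<open>A\<close> with its mirror image produces exactly the reflected overlaps.\<close>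
  have ab_le: "corr a b z \<le> ennreal d" for z
  proof -
    have "corr a b z = (\<integral>\<^sup>+x. indicator (A \<inter> {x. (1 - z) - x \<in> A}) x \<partial>lborel)"
      unfolding corr_def b_def a_def by (intro nn_integral_cong) (auto simp: indicator_def algebra_simps)
    also have "\<dots> = emeasure lborel (A \<inter> {x. (1 - z) - x \<in> A})"
      by (intro nn_integral_indicator) measurable
    finally show ?thesis using d(1) by (simp add: reflect_def)
  qed
  have bb: "corr b b z = G z" for z
  proof -
    have "corr b b z = (\<integral>\<^sup>+x. a ((1 - z) - x) * a ((1 - z) - x + z) \<partial>lborel)"
      unfolding corr_def b_def by (intro nn_integral_cong) (auto simp: algebra_simps)
    also have "\<dots> = G z"
      unfolding G_def corr_def by (rule nn_integral_reflect) measurable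
    finally show ?thesis .
  qed
  \<comment> \<open>The exchange identity turns translated overlaps into reflected ones, which \<open>d\<close> bounds.\<close>
  have int_G2: "(\<integral>\<^sup>+z. (G z)\<^sup>2 \<partial>lborel) \<le> ennreal (d * \<epsilon>\<^sup>2)"
  proof -
    have "(\<integral>\<^sup>+z. (G z)\<^sup>2 \<partial>lborel) = (\<integral>\<^sup>+z. corr a a z * corr b b z \<partial>lborel)"
      by (simp add: power2_eq_square bb G_def)
    also have "\<dots> = (\<integral>\<^sup>+z. corr a b z * corr a b z \<partial>lborel)"
      by (rule nn_integral_corr_mult) measurable
    also have "\<dots> \<le> (\<integral>\<^sup>+z. ennreal d * corr a b z \<partial>lborel)"
      using ab_le by (intro nn_integral_mono mult_right_mono) auto
    also have "\<dots> = ennreal (d * \<epsilon>\<^sup>2)"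
      using \<epsilon>(2) d(2) by (simp add: nn_integral_cmult nn_integral_corr int_a int_b power2_eq_square ennreal_mult)
    finally show ?thesis .
  qed
  define w where "w t = corr \<psi> a t + corr \<psi> b t" for t
  have [measurable]: "w \<in> borel_measurable borel"
    unfolding w_def[abs_def] by measurable
  have int_w: "(\<integral>\<^sup>+t. w t \<partial>lborel) = ennreal (2 * h * \<epsilon>)"
  proof -
    have "(\<integral>\<^sup>+t. w t \<partial>lborel) = ennreal h * ennreal \<epsilon> + ennreal h * ennreal \<epsilon>"
      unfolding w_def by (simp add: nn_integral_add nn_integral_corr int_\<psi> int_a int_b)
    also have "\<dots> = ennreal (h * \<epsilon> + h * \<epsilon>)"
      using h \<epsilon>(2) by (simp only: ennreal_mult ennreal_plus mult_nonneg_nonneg)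
    also have "h * \<epsilon> + h * \<epsilon> = 2 * h * \<epsilon>" by simp
    finally show ?thesis .
  qed
  let ?X = "\<integral>\<^sup>+z. T z * G z \<partial>lborel"
  have int_w2: "(\<integral>\<^sup>+t. (w t)\<^sup>2 \<partial>lborel) \<le> 2 * ?X + ennreal (2 * h\<^sup>2 * d)"
  proof -
    have "(\<integral>\<^sup>+t. (w t)\<^sup>2 \<partial>lborel) = (\<integral>\<^sup>+t. corr \<psi> a t * corr \<psi> a t + (corr \<psi> b t * corr \<psi> b t
        + 2 * (corr \<psi> a t * corr \<psi> b t)) \<partial>lborel)"
      unfolding w_def by (intro nn_integral_cong) (simp add: power2_eq_square algebra_simps mult_2)
    also have "\<dots> = ?X + (?X + 2 * (\<integral>\<^sup>+t. T t * corr a b t \<partial>lborel))"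
      by (simp add: nn_integral_add nn_integral_cmult nn_integral_corr_mult[of \<psi> _ \<psi>]
          bb T_def[symmetric] G_def[symmetric])
    finally have split: "(\<integral>\<^sup>+t. (w t)\<^sup>2 \<partial>lborel) = \<dots>" .
    have "(\<integral>\<^sup>+t. T t * corr a b t \<partial>lborel) \<le> (\<integral>\<^sup>+t. T t * ennreal d \<partial>lborel)"
      using ab_le by (intro nn_integral_mono mult_left_mono) auto
    also have "\<dots> = ennreal (h\<^sup>2 * d)"
      using d(2) by (simp add: nn_integral_multc int_T ennreal_mult)
    finally have "(\<integral>\<^sup>+t. (w t)\<^sup>2 \<partial>lborel) \<le> ?X + (?X + 2 * ennreal (h\<^sup>2 * d))"
      unfolding split by (intro add_left_mono mult_left_mono) auto
    also have "\<dots> = 2 * ?X + 2 * ennreal (h\<^sup>2 * d)"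
      by (simp only: mult_2 add.assoc)
    also have "2 * ennreal (h\<^sup>2 * d) = ennreal (2 * h\<^sup>2 * d)"
      using d(2) by (simp add: ennreal_mult mult.assoc)
    finally show ?thesis .
  qed
  have window: "ennreal (4 * h\<^sup>2 * \<epsilon>\<^sup>2 / (1 + h)) \<le> 2 * ?X + ennreal (2 * h\<^sup>2 * d)"
  proof -
    let ?I = "{- (h / 2)..1 + h / 2}"
    have supp: "w t = w t * indicator ?I t" for t
    proof (cases "t \<in> ?I")
      case False
      have zero: "\<psi> x * a (x + t) = 0" "\<psi> x * b (x + t) = 0" for x
      proof -
        have "x \<in> {- (h / 2)..h / 2} \<Longrightarrow> \<not> (0 \<le> x + t \<and> x + t \<le> 1)" using False by auto
        then show "\<psi> x * a (x + t) = 0" "\<psi> x * b (x + t) = 0"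
          using A by (auto simp: \<psi>_def a_def b_def indicator_def)
      qed
      show ?thesis unfolding w_def corr_def zero by simp
    qed simp
    have "2 * (ennreal \<kappa> * ennreal (2 * h * \<epsilon>)) = (\<integral>\<^sup>+t. 2 * (w t * (ennreal \<kappa> * indicator ?I t)) \<partial>lborel)"
    proof -
      have "(\<integral>\<^sup>+t. 2 * (w t * (ennreal \<kappa> * indicator ?I t)) \<partial>lborel)
          = (\<integral>\<^sup>+t. (2 * ennreal \<kappa>) * w t \<partial>lborel)"
        by (intro nn_integral_cong, subst (2) supp) (simp add: ac_simps)
      then show ?thesis by (simp add: nn_integral_cmult int_w mult.assoc)
    qed
    also have "\<dots> \<le> (\<integral>\<^sup>+t. (w t)\<^sup>2 + (ennreal \<kappa> * indicator ?I t)\<^sup>2 \<partial>lborel)"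
      by (intro nn_integral_mono two_mult_le_sum_squares_ennreal)
    also have "\<dots> = (\<integral>\<^sup>+t. (w t)\<^sup>2 \<partial>lborel) + (\<integral>\<^sup>+t. (ennreal \<kappa>)\<^sup>2 * indicator ?I t \<partial>lborel)"
      by (subst nn_integral_add[symmetric]) (auto intro!: nn_integral_cong simp: indicator_def)
    also have "(\<integral>\<^sup>+t. (ennreal \<kappa>)\<^sup>2 * indicator ?I t \<partial>lborel) = ennreal (\<kappa>\<^sup>2 * (1 + h))"
      using h \<epsilon>(2) by (simp add: nn_integral_cmult \<kappa>_def ennreal_power ennreal_mult add.commute)
    also have "2 * (ennreal \<kappa> * ennreal (2 * h * \<epsilon>)) = ennreal (2 * \<kappa> * (2 * h * \<epsilon>))"
    proof -
      have "2 * (ennreal x * ennreal y) = ennreal (2 * x * y)" if "0 \<le> x" "0 \<le> y" for x y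
        using that by (simp add: ennreal_mult mult.assoc)
      then show ?thesis using h \<epsilon>(2) \<kappa> by (metis mult_nonneg_nonneg zero_le_numeral)
    qed
    finally have "ennreal (2 * \<kappa> * (2 * h * \<epsilon>)) \<le> (2 * ?X + ennreal (2 * h\<^sup>2 * d)) + ennreal (\<kappa>\<^sup>2 * (1 + h))"
      by (rule order_trans[OF _ add_right_mono[OF int_w2]])
    moreover have "2 * \<kappa> * (2 * h * \<epsilon>) = 4 * h\<^sup>2 * \<epsilon>\<^sup>2 / (1 + h) + \<kappa>\<^sup>2 * (1 + h)"
    proof -
      have "\<kappa> * (1 + h) = 2 * h * \<epsilon>" using h by (simp add: \<kappa>_def)
      then have "\<kappa>\<^sup>2 * (1 + h) = \<kappa> * (2 * h * \<epsilon>)"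
        by (simp only: power2_eq_square mult.assoc)
      moreover have "4 * h\<^sup>2 * \<epsilon>\<^sup>2 / (1 + h) = \<kappa> * (2 * h * \<epsilon>)"
        by (simp add: \<kappa>_def power2_eq_square)
      ultimately show ?thesis by simp
    qed
    moreover have "0 \<le> 4 * h\<^sup>2 * \<epsilon>\<^sup>2 / (1 + h)" "0 \<le> \<kappa>\<^sup>2 * (1 + h)" using h by auto
    ultimately have "ennreal (\<kappa>\<^sup>2 * (1 + h)) + ennreal (4 * h\<^sup>2 * \<epsilon>\<^sup>2 / (1 + h))
        \<le> ennreal (\<kappa>\<^sup>2 * (1 + h)) + (2 * ?X + ennreal (2 * h\<^sup>2 * d))"
      by (simp add: add.commute)
    then show ?thesis unfolding ennreal_add_left_cancel_le by simp
  qed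
  have overlap: "ennreal (2 * \<beta>) * ?X + ennreal (2 * c * \<epsilon>\<^sup>2)
      \<le> ennreal (\<beta>\<^sup>2 * (2 * h ^ 3 / 3) + 2 * c * \<beta> * h\<^sup>2 + 2 * c\<^sup>2 + d * \<epsilon>\<^sup>2)"
  proof -
    let ?J = "{- 1..1::real}"
    have supp: "G z = 0" if "z \<notin> ?J" for z
    proof -
      have zero: "a x * a (x + z) = 0" for x
      proof (rule ccontr)
        assume "a x * a (x + z) \<noteq> 0"
        then have "x \<in> {0..<1}" "x + z \<in> {0..<1}"
          using A by (auto simp: a_def indicator_def split: if_splits)
        then show False using that by auto
      qed
      show ?thesis unfolding G_def corr_def zero by simp
    qed
    have "ennreal (2 * \<beta>) * ?X + ennreal (2 * c * \<epsilon>\<^sup>2)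
        = (\<integral>\<^sup>+z. ennreal (2 * \<beta>) * (T z * G z) + ennreal (2 * c) * G z \<partial>lborel)"
      using bc by (simp add: nn_integral_add nn_integral_cmult int_G ennreal_mult)
    also have "\<dots> \<le> (\<integral>\<^sup>+z. ennreal (\<beta>\<^sup>2) * (T z)\<^sup>2 + ennreal (2 * c * \<beta>) * T z
        + ennreal (c\<^sup>2) * indicator ?J z + (G z)\<^sup>2 \<partial>lborel)"
    proof (rule nn_integral_mono)
      fix z
      show "ennreal (2 * \<beta>) * (T z * G z) + ennreal (2 * c) * G z
        \<le> ennreal (\<beta>\<^sup>2) * (T z)\<^sup>2 + ennreal (2 * c * \<beta>) * T z + ennreal (c\<^sup>2) * indicator ?J z + (G z)\<^sup>2"
      proof (cases "z \<in> ?J")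
        case True
        have "ennreal (2 * \<beta>) * (T z * G z) + ennreal (2 * c) * G z
            = 2 * ((ennreal \<beta> * T z + ennreal c) * G z)"
          using bc by (simp add: ennreal_mult algebra_simps)
        also have "\<dots> \<le> (ennreal \<beta> * T z + ennreal c)\<^sup>2 + (G z)\<^sup>2"
          by (rule two_mult_le_sum_squares_ennreal)
        also have "(ennreal \<beta> * T z + ennreal c)\<^sup>2
            = ennreal (\<beta>\<^sup>2) * (T z)\<^sup>2 + ennreal (2 * c * \<beta>) * T z + ennreal (c\<^sup>2)"
          using bc by (simp add: power2_sum power_mult_distrib ennreal_power ennreal_mult ac_simps)
        finally show ?thesis using True by simp
      qed (simp add: supp)
    qed
    also have "\<dots> = ennreal (\<beta>\<^sup>2) * (\<integral>\<^sup>+z. (T z)\<^sup>2 \<partial>lborel) + ennreal (2 * c * \<beta>) * ennreal (h\<^sup>2)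
        + ennreal (c\<^sup>2) * ennreal 2 + (\<integral>\<^sup>+z. (G z)\<^sup>2 \<partial>lborel)"
      by (simp add: nn_integral_add nn_integral_cmult int_T)
    also have "\<dots> \<le> ennreal (\<beta>\<^sup>2) * ennreal (2 * h ^ 3 / 3) + ennreal (2 * c * \<beta>) * ennreal (h\<^sup>2)
        + ennreal (c\<^sup>2) * ennreal 2 + ennreal (d * \<epsilon>\<^sup>2)"
      using int_T2 int_G2 by (intro add_mono mult_left_mono) auto
    also have "\<dots> = ennreal (\<beta>\<^sup>2 * (2 * h ^ 3 / 3) + 2 * c * \<beta> * h\<^sup>2 + 2 * c\<^sup>2 + d * \<epsilon>\<^sup>2)"
      using bc h d(2) by (simp add: ennreal_mult[symmetric] ennreal_plus[symmetric] mult.commute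
          del: ennreal_plus ennreal_numeral)
    finally show ?thesis .
  qed
  have "ennreal (2 * \<beta>) * ?X \<noteq> top"
    using overlap by (metis ennreal_add_eq_top ennreal_neq_top top.extremum_uniqueI)
  then have "?X \<noteq> top" using bc by (auto simp: ennreal_mult_eq_top_iff)
  then obtain x where x: "?X = ennreal x" "0 \<le> x" by (cases ?X) auto
  have "4 * h\<^sup>2 * \<epsilon>\<^sup>2 / (1 + h) \<le> 2 * x + 2 * h\<^sup>2 * d"
    using window x d(2) h
    by (simp add: ennreal_mult[symmetric] ennreal_plus[symmetric] ennreal_numeral[symmetric] ennreal_le_iff
        del: ennreal_plus ennreal_numeral)
  then have "\<beta> * (4 * h\<^sup>2 * \<epsilon>\<^sup>2 / (1 + h)) \<le> \<beta> * (2 * x + 2 * h\<^sup>2 * d)"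
    using bc by (intro mult_left_mono) auto
  moreover have "2 * \<beta> * x + 2 * c * \<epsilon>\<^sup>2
      \<le> \<beta>\<^sup>2 * (2 * h ^ 3 / 3) + 2 * c * \<beta> * h\<^sup>2 + 2 * c\<^sup>2 + d * \<epsilon>\<^sup>2"
    using overlap x d(2) h bc
    by (simp add: ennreal_mult[symmetric] ennreal_plus[symmetric] ennreal_le_iff del: ennreal_plus)
  ultimately show ?thesis by (simp add: algebra_simps)
qed

text \<open>
  The choices \<open>h = 6/25\<close>, \<open>\<beta> = 19/5 \<epsilon>\<^sup>2\<close> and \<open>c = 39/100 \<epsilon>\<^sup>2\<close> are close to optimal in the previous
  lemma; the true optimum is just below \<open>0.611 \<epsilon>\<^sup>2\<close>.
\<close>
lemma reflected_overlap_ge: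
  fixes A :: "real set" and \<epsilon> d :: real
  assumes A: "A \<in> sets borel" "A \<subseteq> {0..<1}"
    and \<epsilon>: "emeasure lborel A = ennreal \<epsilon>" "0 < \<epsilon>"
    and d: "\<And>t. emeasure lborel (A \<inter> reflect t A) \<le> ennreal d" "0 \<le> d"
  shows "61 / 100 * \<epsilon>\<^sup>2 \<le> d"
proof -
  define E where "E = \<epsilon>\<^sup>2"
  have E: "0 < E" using \<epsilon> by (simp add: E_def)
  have "4 * (19 / 5 * E) * (6 / 25)\<^sup>2 * E / (1 + 6 / 25) - 2 * (19 / 5 * E) * (6 / 25)\<^sup>2 * d
      \<le> (19 / 5 * E)\<^sup>2 * (2 * (6 / 25) ^ 3 / 3) + 2 * (39 / 100 * E) * (19 / 5 * E) * (6 / 25)\<^sup>2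
        + 2 * (39 / 100 * E)\<^sup>2 - 2 * (39 / 100 * E) * E + d * E"
    unfolding E_def using assms E by (intro reflected_overlap_bound) (auto simp: E_def)
  then have "E * (61 / 100 * E) \<le> E * d"
    using E by (simp add: power2_eq_square power3_eq_cube field_simps) 
  then show ?thesis using E by (simp add: E_def)
qed

lemma Delta_ge_quadratic:
  assumes \<epsilon>: "0 < \<epsilon>" "\<epsilon> \<le> 1"
  shows "61 / 100 * \<epsilon>\<^sup>2 \<le> Delta \<epsilon>"
proof (rule Delta_geI)
  fix A :: "real set"
  assume A: "A \<subseteq> {0..<1}" "A \<in> sets lebesgue" "emeasure lebesgue A = ennreal \<epsilon>"
  \<comment> \<open>Tonelli's theorem is applied to Borel functions, so pass to a Borel subset of full measure.\<close>
  define S where "S = main_part lborel A"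
  have S: "S \<in> sets borel" using main_part_sets[OF A(2)] by (simp add: S_def)
  have SA: "S \<subseteq> A" using main_part_null_part_Un[OF A(2)] by (auto simp: S_def)
  have mS: "emeasure lborel S = ennreal \<epsilon>"
    using A(2,3) by (simp add: S_def)
  have "D A \<le> ennreal \<epsilon>" using D_le_emeasure[OF A(2)] A(3) by simp
  then have "D A \<noteq> top" using ennreal_less_top le_less_trans less_irrefl by metis
  then obtain d where d: "D A = ennreal d" "0 \<le> d" by (cases "D A") auto
  have "61 / 100 * \<epsilon>\<^sup>2 \<le> d"
  proof (rule reflected_overlap_ge[of S])
    fix t
    have [measurable]: "S \<in> sets borel" by (rule S)
    have "S \<inter> reflect t S \<in> sets borel" unfolding reflect_def by measurable
    then have "emeasure lborel (S \<inter> reflect t S) = emeasure lebesgue (S \<inter> reflect t S)"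
      by simp
    also have "\<dots> \<le> emeasure lebesgue (A \<inter> reflect t A)"
      using SA A(2) by (intro emeasure_mono) auto
    also have "\<dots> \<le> D A"
      unfolding D_eq_SUP_reflect[OF A(2)] by (rule SUP_upper) simp
    finally show "emeasure lborel (S \<inter> reflect t S) \<le> ennreal d" by (simp add: d)
  qed (use S SA A(1) mS \<epsilon> d in auto)
  then show "ennreal (61 / 100 * \<epsilon>\<^sup>2) \<le> D A" by (simp add: d ennreal_leI)
qed (use \<epsilon> in auto)

lemma Delta_ge_cubic:
  assumes \<epsilon>: "0 < \<epsilon>" "\<epsilon> \<le> 1"
  shows "0.5546 * \<epsilon>^2 + 0.088079 * \<epsilon>^3 \<le> Delta \<epsilon>"
proof (cases "\<epsilon> \<le> 62 / 100")
  case True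
  have "0.5546 * \<epsilon>^2 + 0.088079 * \<epsilon>^3 = (0.5546 + 0.088079 * \<epsilon>) * \<epsilon>\<^sup>2"
    by (simp add: power2_eq_square power3_eq_cube algebra_simps)
  also have "\<dots> \<le> 61 / 100 * \<epsilon>\<^sup>2"
    using True by (intro mult_right_mono) auto
  also have "\<dots> \<le> Delta \<epsilon>" by (rule Delta_ge_quadratic[OF \<epsilon>])
  finally show ?thesis .
next
  case False
  \<comment> \<open>On \<open>[0.62, 1]\<close> the powers of \<open>\<epsilon>\<close> lie below their chords, and the resulting linear
      inequality is checked at the two ends.\<close>
  have "0 \<le> (\<epsilon> - 62 / 100) * (1 - \<epsilon>)" using False \<epsilon> by simp
  also have "\<dots> = 1.62 * \<epsilon> - 0.62 - \<epsilon>\<^sup>2" by (simp add: power2_eq_square field_simps)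
  finally have sq: "\<epsilon>\<^sup>2 \<le> 1.62 * \<epsilon> - 0.62" by simp
  have "\<epsilon> ^ 3 = \<epsilon> * \<epsilon>\<^sup>2" by (simp add: power2_eq_square power3_eq_cube)
  also have "\<dots> \<le> \<epsilon> * (1.62 * \<epsilon> - 0.62)" using sq \<epsilon> by (intro mult_left_mono) auto
  also have "\<dots> = 1.62 * \<epsilon>\<^sup>2 - 0.62 * \<epsilon>" by (simp add: power2_eq_square algebra_simps)
  finally have "0.5546 * \<epsilon>^2 + 0.088079 * \<epsilon>^3 \<le> 2 * \<epsilon> - 1" using sq False \<epsilon> by simp
  also have "\<dots> \<le> Delta \<epsilon>" using False \<epsilon> by (intro Delta_ge_two_mult) auto
  finally show ?thesis .
qed

section \<open>Rounding a density to a zero-one sequence\<close>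

definition autoconv :: "(nat \<Rightarrow> real) \<Rightarrow> nat \<Rightarrow> real" where
  "autoconv p k = (\<Sum>i\<le>k. p i * p (k - i))"

text \<open>
  Each unordered pair of distinct indices with sum \<open>k\<close> occurs once, so no two of these products
  share a variable. This makes the generating polynomial in \<open>exists_thinning_exp\<close> affine in
  every variable.
\<close>
definition half_autoconv :: "(nat \<Rightarrow> real) \<Rightarrow> nat \<Rightarrow> real" where
  "half_autoconv p k = (\<Sum>i | 2 * i < k. p i * p (k - i))"

lemma finite_half [simp]: "finite {i::nat. 2 * i < k}"
  by (rule finite_subset[of _ "{..k}"]) auto

lemma autoconv_eq_half_autoconv:
  "autoconv p k = 2 * half_autoconv p k + (if even k then (p (k div 2))\<^sup>2 else 0)"
proof -
  let ?f = "\<lambda>i. p i * p (k - i)"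
  have split: "{..k} = {i. 2 * i < k} \<union> ({i. 2 * i = k} \<union> {i. i \<le> k \<and> k < 2 * i})"
    by auto
  have fin: "finite {i::nat. 2 * i = k}" "finite {i. i \<le> k \<and> k < 2 * i}"
    by (rule finite_subset[of _ "{..k}"]; auto)+
  have "autoconv p k = half_autoconv p k + (sum ?f {i. 2 * i = k} + sum ?f {i. i \<le> k \<and> k < 2 * i})"
  proof -
    have "sum ?f ({i. 2 * i = k} \<union> {i. i \<le> k \<and> k < 2 * i})
        = sum ?f {i. 2 * i = k} + sum ?f {i. i \<le> k \<and> k < 2 * i}"
      by (rule sum.union_disjoint[OF fin]) auto
    moreover have "autoconv p k = half_autoconv p k + sum ?f ({i. 2 * i = k} \<union> {i. i \<le> k \<and> k < 2 * i})"
      unfolding autoconv_def half_autoconv_def split using fin by (intro sum.union_disjoint) auto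
    ultimately show ?thesis by simp
  qed
  moreover have "sum ?f {i. i \<le> k \<and> k < 2 * i} = half_autoconv p k"
    unfolding half_autoconv_def
    by (rule sum.reindex_bij_witness[of _ "\<lambda>i. k - i" "\<lambda>i. k - i"]) (auto simp: mult.commute)
  moreover have "sum ?f {i. 2 * i = k} = (if even k then (p (k div 2))\<^sup>2 else 0)"
  proof (cases "even k")
    case True
    then have "{i. 2 * i = k} = {k div 2}" by auto
    moreover have "k - k div 2 = k div 2" using True by (elim evenE) simp
    ultimately show ?thesis using True by (simp add: power2_eq_square)
  next
    case False
    then have "{i. 2 * i = k} = {}" by auto
    then show ?thesis using False by (simp only: sum.empty if_False)
  qed
  ultimately show ?thesis by simp
qed

text \<open>
  Replacing each cell by \<open>N\<close> equal ones interpolates: for a fixed residue of \<open>i\<close> modulo \<open>N\<close> the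
  terms of the refined sum form one full autoconvolution sum of \<open>p\<close>.
\<close>
lemma autoconv_refine_le:
  assumes N: "N > 0" and R: "\<And>k. autoconv p k \<le> R" "0 \<le> R"
  shows "autoconv (\<lambda>i. p (i div N)) k \<le> real N * R"
proof -
  let ?f = "\<lambda>i. p (i div N) * p ((k - i) div N)"
  have "autoconv (\<lambda>i. p (i div N)) k = (\<Sum>u<N. sum ?f {i \<in> {..k}. i mod N = u})"
    unfolding autoconv_def using N by (intro sum.group[symmetric]) auto
  also have "\<dots> \<le> (\<Sum>u<N. R)"
  proof (rule sum_mono)
    fix u assume "u \<in> {..<N}"
    then have u: "u < N" by simp
    have step: "sum ?f {i \<in> {..k}. i mod N = u} = autoconv p ((k - u) div N)" if "u \<le> k"
    proof -
      define q s where "q = (k - u) div N" and "s = (k - u) mod N"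
      have k: "k = q * N + s + u" and s: "s < N"
        using that N by (auto simp: q_def s_def)
      have div: "(k - (a * N + u)) div N = q - a" if "a \<le> q" for a
      proof -
        have "k - (a * N + u) = s + (q - a) * N"
          using that by (simp add: k diff_mult_distrib)
        then show ?thesis using s by simp
      qed
      have "sum ?f {i \<in> {..k}. i mod N = u} = (\<Sum>a\<le>q. p a * p (q - a))"
      proof (rule sum.reindex_bij_witness[of _ "\<lambda>a. a * N + u" "\<lambda>i. i div N"])
        fix i assume i: "i \<in> {i \<in> {..k}. i mod N = u}"
        show "i div N * N + u = i" using i by auto
        have "i = i div N * N + u" using i by auto
        then have "(i div N) * N + u \<le> q * N + s + u" using i k by simp
        then have "(i div N) * N < (q + 1) * N" using s by simp
        then have "i div N < q + 1" by (rule mult_less_cancel2[THEN iffD1, THEN conjunct2])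
        then show "i div N \<in> {..q}" by simp
        then show "p (i div N) * p (q - i div N) = ?f i"
          using div[of "i div N"] \<open>i = _\<close> by simp
      next
        fix a assume a: "a \<in> {..q}"
        show "(a * N + u) div N = a" using u by simp
        have "a * N \<le> q * N" using a by simp
        then have "a * N + u \<le> k" using k by linarith
        then show "a * N + u \<in> {i \<in> {..k}. i mod N = u}" using u by simp
      qed
      then show ?thesis by (simp add: autoconv_def q_def)
    qed
    show "sum ?f {i \<in> {..k}. i mod N = u} \<le> R"
    proof (cases "u \<le> k")
      case True then show ?thesis using step R by simp
    next
      case False
      then have "{i \<in> {..k}. i mod N = u} = {}"
        using order_trans[OF mod_less_eq_dividend] by auto
      then show ?thesis using R by (simp only: sum.empty)
    qed
  qed
  finally show ?thesis by simp
qed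

definition affine_in :: "nat \<Rightarrow> ((nat \<Rightarrow> real) \<Rightarrow> real) \<Rightarrow> bool" where
  "affine_in j F \<longleftrightarrow> (\<forall>x. \<exists>a b. \<forall>t. F (x(j := t)) = a + b * t)"

lemma affine_inI: "(\<And>x. \<exists>a b. \<forall>t. F (x(j := t)) = a + b * t) \<Longrightarrow> affine_in j F"
  by (simp add: affine_in_def)

lemma affine_in_add:
  assumes "affine_in j F" "affine_in j G"
  shows "affine_in j (\<lambda>x. F x + G x)"
proof (rule affine_inI)
  fix x
  obtain a b a' b' where "\<forall>t. F (x(j := t)) = a + b * t" "\<forall>t. G (x(j := t)) = a' + b' * t"
    using assms unfolding affine_in_def by meson
  then have "\<forall>t. F (x(j := t)) + G (x(j := t)) = (a + a') + (b + b') * t"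
    by (simp add: algebra_simps)
  then show "\<exists>a b. \<forall>t. F (x(j := t)) + G (x(j := t)) = a + b * t" by blast
qed

lemma affine_in_const_mult:
  assumes "affine_in j F"
  shows "affine_in j (\<lambda>x. c * F x)"
proof (rule affine_inI)
  fix x
  obtain a b where "\<forall>t. F (x(j := t)) = a + b * t"
    using assms unfolding affine_in_def by meson
  then have "\<forall>t. c * F (x(j := t)) = (c * a) + (c * b) * t"
    by (simp add: algebra_simps)
  then show "\<exists>a b. \<forall>t. c * F (x(j := t)) = a + b * t" by blast
qed

lemma affine_in_const: "affine_in j (\<lambda>x. c)"
  by (rule affine_inI) (metis add.right_neutral mult_zero_left)

lemma affine_in_sum:
  assumes "\<And>k. k \<in> K \<Longrightarrow> affine_in j (F k)"
  shows "affine_in j (\<lambda>x. \<Sum>k\<in>K. F k x)"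
  using assms by (induction K rule: infinite_finite_induct)
    (auto intro!: affine_in_const affine_in_add)

lemma affine_in_prod:
  assumes fin: "finite K" and one: "\<And>k x t. k \<in> K \<Longrightarrow> k \<noteq> k0 \<Longrightarrow> F k (x(j := t)) = F k x"
    and aff: "k0 \<in> K \<Longrightarrow> affine_in j (F k0)"
  shows "affine_in j (\<lambda>x. \<Prod>k\<in>K. F k x)"
proof (rule affine_inI)
  fix x
  have rest: "(\<Prod>k\<in>K - {k0}. F k (x(j := t))) = (\<Prod>k\<in>K - {k0}. F k x)" for t
    using one by (intro prod.cong) auto
  show "\<exists>a b. \<forall>t. (\<Prod>k\<in>K. F k (x(j := t))) = a + b * t"
  proof (cases "k0 \<in> K")
    case True
    obtain a b where ab: "\<forall>t. F k0 (x(j := t)) = a + b * t"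
      using aff[OF True] unfolding affine_in_def by meson
    have "\<forall>t. (\<Prod>k\<in>K. F k (x(j := t)))
        = a * (\<Prod>k\<in>K - {k0}. F k x) + (b * (\<Prod>k\<in>K - {k0}. F k x)) * t"
      by (subst prod.remove[OF fin True]) (simp add: rest ab[rule_format] algebra_simps)
    then show ?thesis by blast
  next
    case False
    then have "K - {k0} = K" by blast
    then have "\<forall>t. (\<Prod>k\<in>K. F k (x(j := t))) = (\<Prod>k\<in>K. F k x) + 0 * t"
      using rest by simp
    then show ?thesis by blast
  qed
qed

text \<open>
  The method of conditional expectations: an affine function of one variable in \<open>[0, 1]\<close> is
  minimal at an end, so the coordinates can be rounded one after the other.
\<close>
lemma multiaffine_vertex_le:
  assumes aff: "\<And>j. j < m \<Longrightarrow> affine_in j F" and p: "\<And>i. p i \<in> {0..1}"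
  shows "\<exists>X. F X \<le> F p \<and> (\<forall>i<m. X i \<in> {0, 1}) \<and> (\<forall>i\<ge>m. X i = p i)"
  using aff
proof (induction m)
  case 0
  then show ?case by (intro exI[of _ p]) auto
next
  case (Suc m)
  obtain X where X: "F X \<le> F p" "\<forall>i<m. X i \<in> {0, 1}" "\<forall>i\<ge>m. X i = p i"
    using Suc by fastforce
  obtain a b where ab: "\<And>t. F (X(m := t)) = a + b * t"
    using Suc.prems[of m] unfolding affine_in_def by (meson lessI)
  have "F X = a + b * p m"
    using ab[of "p m"] X(3) by (metis fun_upd_triv order_refl)
  moreover have "0 \<le> p m" "p m \<le> 1" using p[of m] by auto
  ultimately have "\<exists>t\<in>{0, 1}. a + b * t \<le> F X"
    by (cases "b \<le> 0") (auto simp: mult_le_cancel_left1 mult_nonneg_nonneg)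
  then obtain t where "t \<in> {0, 1}" "a + b * t \<le> F X" by blast
  then show ?case
    using X ab[of t] by (intro exI[of _ "X(m := t)"]) (auto simp: less_Suc_eq simp del: fun_upd_apply, auto)
qed

lemma half_autoconv_le:
  assumes p: "\<And>i. p i \<in> {0..1}" and supp: "\<And>i. m \<le> i \<Longrightarrow> p i = 0"
  shows "half_autoconv p k \<le> m"
proof -
  have "half_autoconv p k \<le> (\<Sum>i | 2 * i < k. of_bool (i < m))"
    unfolding half_autoconv_def
  proof (rule sum_mono)
    fix i
    have "p i * p (k - i) \<le> 1 * 1" using p by (intro mult_mono) auto
    then show "p i * p (k - i) \<le> of_bool (i < m)" using supp[of i] by auto
  qed
  also have "\<dots> = card ({i. 2 * i < k} \<inter> {i. i < m})"
    by (subst sum_of_bool_eq) auto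
  also have "\<dots> \<le> card {..<m}"
    by (intro of_nat_mono card_mono) auto
  finally show ?thesis by simp
qed

lemma half_autoconv_eq_0:
  assumes supp: "\<And>i. m \<le> i \<Longrightarrow> p i = 0" and k: "2 * m \<le> k"
  shows "half_autoconv p k = 0"
  unfolding half_autoconv_def using supp k by (intro sum.neutral) (auto intro!: disjI2)

lemma exp_le_quadratic:
  fixes x :: real
  assumes "0 \<le> x" "x \<le> 1"
  shows "exp x - 1 \<le> x + x\<^sup>2" "x - x\<^sup>2 \<le> 1 - exp (- x)"
proof -
  show "exp x - 1 \<le> x + x\<^sup>2" using exp_bound[OF assms] by simp
  have "exp (- x) \<le> 1 / (1 + x)"
    using exp_ge_add_one_self[of x] assms by (simp add: exp_minus field_simps)
  also have "\<dots> \<le> 1 - x + x\<^sup>2"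
    using assms by (simp add: field_simps power2_eq_square)
  finally show "x - x\<^sup>2 \<le> 1 - exp (- x)" by simp
qed

text \<open>
  If \<open>X i\<close> are independent with expectation \<open>p i\<close>, then \<open>E k p\<close> is the expectation of
  \<open>exp (\<theta> * (half_autoconv X k - half_autoconv p k))\<close>, since the pairs involved are disjoint,
  and \<open>C p\<close> that of \<open>exp (\<theta> * (sum of p - sum of X))\<close>. Each of these \<open>2 m + 1\<close> expectations is
  at most \<open>exp (\<theta>\<^sup>2 m)\<close>. Rounding \<open>p\<close> to zeros and ones without increasing their sum bounds
  every summand by \<open>(2 m + 1) exp (\<theta>\<^sup>2 m)\<close>, and a logarithm finishes the proof.
\<close>
lemma exists_thinning_exp:
  assumes p: "\<And>i. p i \<in> {0..1}" and supp: "\<And>i. m \<le> i \<Longrightarrow> p i = 0"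
    and \<theta>: "0 < \<theta>" "\<theta> \<le> (1::real)"
  shows "\<exists>X::nat \<Rightarrow> real. (\<forall>i. X i \<in> {0, 1}) \<and> (\<forall>i\<ge>m. X i = 0)
    \<and> (\<forall>k. \<theta> * half_autoconv X k \<le> \<theta> * half_autoconv p k + (ln (2 * real m + 1) + \<theta>\<^sup>2 * m))
    \<and> \<theta> * (\<Sum>i<m. p i) \<le> \<theta> * (\<Sum>i<m. X i) + (ln (2 * real m + 1) + \<theta>\<^sup>2 * m)"
proof -
  define E where "E k x = exp (- \<theta> * half_autoconv p k)
      * (\<Prod>i | 2 * i < k. 1 + (exp \<theta> - 1) * (x i * x (k - i)))" for k and x :: "nat \<Rightarrow> real"
  define C where "C x = exp (\<theta> * (\<Sum>i<m. p i)) * (\<Prod>i<m. 1 - (1 - exp (- \<theta>)) * x i)"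
    for x :: "nat \<Rightarrow> real"
  define F where "F x = (\<Sum>k<2*m. E k x) + C x" for x
  \<comment> \<open>Only the factor that pairs \<open>j\<close> with \<open>k - j\<close> involves the variable \<open>j\<close>.\<close>
  have affE: "affine_in j (E k)" for j k
    unfolding E_def
  proof (intro affine_in_const_mult affine_in_prod[where ?k0.0 = "min j (k - j)"])
    fix i and x :: "nat \<Rightarrow> real" and t
    assume "i \<in> {i. 2 * i < k}" "i \<noteq> min j (k - j)"
    then have "i \<noteq> j" "k - i \<noteq> j" by auto
    then show "1 + (exp \<theta> - 1) * ((x(j := t)) i * (x(j := t)) (k - i))
      = 1 + (exp \<theta> - 1) * (x i * x (k - i))" by simp
  next
    let ?i = "min j (k - j)"
    assume i: "?i \<in> {i. 2 * i < k}"
    show "affine_in j (\<lambda>x. 1 + (exp \<theta> - 1) * (x ?i * x (k - ?i)))"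
    proof (intro affine_in_add affine_in_const affine_in_const_mult affine_inI)
      fix x :: "nat \<Rightarrow> real"
      have "\<forall>t. (x(j := t)) ?i * (x(j := t)) (k - ?i)
          = 0 + (if j \<le> k then x (k - j) else x 0 * x k) * t" if "j \<le> k"
        using i that by (cases "j \<le> k - j") (auto simp: min_def)
      moreover have "\<forall>t. (x(j := t)) ?i * (x(j := t)) (k - ?i) = x 0 * x k + 0 * t" if "\<not> j \<le> k"
        using i that by auto
      ultimately show "\<exists>a b. \<forall>t. (x(j := t)) ?i * (x(j := t)) (k - ?i) = a + b * t" by blast
    qed
  qed auto
  have affC: "affine_in j C" for j
    unfolding C_def
  proof (intro affine_in_const_mult affine_in_prod[where ?k0.0 = j])
    show "affine_in j (\<lambda>x. 1 - (1 - exp (- \<theta>)) * x j)"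
      by (rule affine_inI, rule exI[of _ 1], rule exI[of _ "- (1 - exp (- \<theta>))"])
        (simp add: algebra_simps)
  qed auto
  have aff: "affine_in j F" for j
    unfolding F_def by (intro affine_in_add affine_in_sum affE affC)
  have e: "0 \<le> exp \<theta> - 1" "0 \<le> 1 - exp (- \<theta>)" using \<theta> by auto
  have Ep: "E k p \<le> exp (\<theta>\<^sup>2 * m)" for k
  proof -
    have "(\<Prod>i | 2 * i < k. 1 + (exp \<theta> - 1) * (p i * p (k - i)))
        \<le> (\<Prod>i | 2 * i < k. exp ((exp \<theta> - 1) * (p i * p (k - i))))"
      using p e by (intro prod_mono conjI add_nonneg_nonneg mult_nonneg_nonneg exp_ge_add_one_self) auto
    also have "\<dots> = exp ((exp \<theta> - 1) * half_autoconv p k)"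
      by (simp add: exp_sum half_autoconv_def sum_distrib_left)
    also have "\<dots> \<le> exp ((\<theta> + \<theta>\<^sup>2) * half_autoconv p k)"
      using exp_le_quadratic[of \<theta>] \<theta> p
      by (simp add: mult_right_mono half_autoconv_def sum_nonneg)
    finally have "E k p \<le> exp (- \<theta> * half_autoconv p k) * exp ((\<theta> + \<theta>\<^sup>2) * half_autoconv p k)"
      unfolding E_def by (intro mult_left_mono) auto
    also have "\<dots> = exp (\<theta>\<^sup>2 * half_autoconv p k)"
      by (simp add: exp_add[symmetric] algebra_simps)
    also have "\<dots> \<le> exp (\<theta>\<^sup>2 * m)"
      using half_autoconv_le[OF p supp] by (simp add: mult_left_mono)
    finally show ?thesis .
  qed
  have Cp: "C p \<le> exp (\<theta>\<^sup>2 * m)"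
  proof -
    have factor: "1 - (1 - exp (- \<theta>)) * p i \<le> exp (- (1 - exp (- \<theta>)) * p i)"
      and factor0: "0 \<le> 1 - (1 - exp (- \<theta>)) * p i" for i
    proof -
      show "1 - (1 - exp (- \<theta>)) * p i \<le> exp (- (1 - exp (- \<theta>)) * p i)"
        using exp_ge_add_one_self[of "- (1 - exp (- \<theta>)) * p i"] by linarith
      have "(1 - exp (- \<theta>)) * p i \<le> 1 * 1" using p e by (intro mult_mono) auto
      then show "0 \<le> 1 - (1 - exp (- \<theta>)) * p i" by simp
    qed
    have "(\<Prod>i<m. 1 - (1 - exp (- \<theta>)) * p i) \<le> (\<Prod>i<m. exp (- (1 - exp (- \<theta>)) * p i))"
      using factor factor0 by (intro prod_mono) auto
    also have "\<dots> = exp (- (1 - exp (- \<theta>)) * (\<Sum>i<m. p i))"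
      by (simp only: exp_sum[symmetric] finite_lessThan sum_distrib_left)
    also have "\<dots> \<le> exp (- (\<theta> - \<theta>\<^sup>2) * (\<Sum>i<m. p i))"
      using exp_le_quadratic[of \<theta>] \<theta> p
      by (simp only: exp_le_cancel_iff, intro mult_right_mono sum_nonneg) auto
    finally have "C p \<le> exp (\<theta> * (\<Sum>i<m. p i)) * exp (- (\<theta> - \<theta>\<^sup>2) * (\<Sum>i<m. p i))"
      unfolding C_def by (intro mult_left_mono) auto
    also have "\<dots> = exp (\<theta>\<^sup>2 * (\<Sum>i<m. p i))"
      by (simp add: exp_add[symmetric] algebra_simps)
    also have "\<dots> \<le> exp (\<theta>\<^sup>2 * m)"
      using sum_mono[of "{..<m}" p "\<lambda>_. 1"] p by (simp add: mult_left_mono)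
    finally show ?thesis .
  qed
  have Fp: "F p \<le> (2 * real m + 1) * exp (\<theta>\<^sup>2 * m)"
  proof -
    have "F p \<le> (\<Sum>k<2*m. exp (\<theta>\<^sup>2 * m)) + exp (\<theta>\<^sup>2 * m)"
      unfolding F_def by (intro add_mono sum_mono Ep Cp)
    then show ?thesis by (simp add: algebra_simps)
  qed
  obtain X where X: "F X \<le> F p" "\<forall>i<m. X i \<in> {0, 1}" "\<forall>i\<ge>m. X i = p i"
    using multiaffine_vertex_le[of m F p] aff p by blast
  have X01: "X i \<in> {0, 1}" for i using X(2,3) supp by (cases "i < m") auto
  have EX: "E k X = exp (\<theta> * half_autoconv X k - \<theta> * half_autoconv p k)" for k
  proof -
    have "(\<Prod>i | 2 * i < k. 1 + (exp \<theta> - 1) * (X i * X (k - i)))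
        = (\<Prod>i | 2 * i < k. exp (\<theta> * (X i * X (k - i))))"
    proof (intro prod.cong refl)
      fix i
      show "1 + (exp \<theta> - 1) * (X i * X (k - i)) = exp (\<theta> * (X i * X (k - i)))"
        using X01[of i] X01[of "k - i"] by auto
    qed
    also have "\<dots> = exp (\<theta> * half_autoconv X k)"
      by (simp add: exp_sum half_autoconv_def sum_distrib_left)
    finally show ?thesis by (simp add: E_def exp_add[symmetric])
  qed
  have CX: "C X = exp (\<theta> * (\<Sum>i<m. p i) - \<theta> * (\<Sum>i<m. X i))"
  proof -
    have "(\<Prod>i<m. 1 - (1 - exp (- \<theta>)) * X i) = (\<Prod>i<m. exp (- \<theta> * X i))"
    proof (intro prod.cong refl)
      fix i
      show "1 - (1 - exp (- \<theta>)) * X i = exp (- \<theta> * X i)"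
        using X01[of i] by auto
    qed
    also have "\<dots> = exp (- \<theta> * (\<Sum>i<m. X i))"
      by (simp only: exp_sum[symmetric] finite_lessThan sum_distrib_left)
    finally show ?thesis by (simp add: C_def exp_add[symmetric])
  qed
  have bound: "y \<le> ln (2 * real m + 1) + \<theta>\<^sup>2 * m" if "exp y \<le> F X" for y
  proof -
    have "exp y \<le> (2 * real m + 1) * exp (\<theta>\<^sup>2 * m)" using that X(1) Fp by linarith
    also have "\<dots> = exp (ln (2 * real m + 1) + \<theta>\<^sup>2 * m)" by (simp add: exp_add)
    finally show ?thesis by simp
  qed
  have ge0: "0 \<le> E k X" "0 \<le> C X" for k by (simp_all add: EX CX)
  have "\<theta> * half_autoconv X k - \<theta> * half_autoconv p k \<le> ln (2 * real m + 1) + \<theta>\<^sup>2 * m" for k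
  proof (cases "k < 2 * m")
    case True
    then have "E k X \<le> (\<Sum>k<2*m. E k X)"
      using ge0 by (intro member_le_sum) auto
    then have "E k X \<le> F X" unfolding F_def using ge0(2) by linarith
    then show ?thesis using bound EX by metis
  next
    case False
    then show ?thesis
      using half_autoconv_eq_0[of m X k] half_autoconv_eq_0[of m p k] X(3) supp by simp
  qed
  moreover have "\<theta> * (\<Sum>i<m. p i) - \<theta> * (\<Sum>i<m. X i) \<le> ln (2 * real m + 1) + \<theta>\<^sup>2 * m"
  proof -
    have "C X \<le> F X" unfolding F_def using ge0 by (simp add: sum_nonneg)
    then show ?thesis using bound CX by metis
  qed
  ultimately show ?thesis
    using X01 X(3) supp by (intro exI[of _ X] conjI allI impI) (simp_all add: diff_le_eq add.commute)
qed

text \<open>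
  The summand 1 accounts for the diagonal term \<open>(X (k div 2))\<^sup>2\<close> of an even \<open>k\<close>.
\<close>
lemma exists_thinning:
  fixes \<eta> :: real and p :: "nat \<Rightarrow> real"
  assumes \<eta>: "0 < \<eta>" "\<eta> \<le> 1"
    and p: "\<And>i. p i \<in> {0..1}" and supp: "\<And>i. m \<le> i \<Longrightarrow> p i = 0"
    and m: "ln (2 * real m + 1) \<le> \<eta>\<^sup>2 * m"
  shows "\<exists>X::nat \<Rightarrow> real. (\<forall>i. X i \<in> {0, 1}) \<and> (\<forall>i\<ge>m. X i = 0)
    \<and> (\<forall>k. autoconv X k \<le> autoconv p k + 4 * \<eta> * m + 1)
    \<and> (\<Sum>i<m. p i) - 2 * \<eta> * m \<le> (\<Sum>i<m. X i)"
proof -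
  have "\<exists>X::nat \<Rightarrow> real. (\<forall>i. X i \<in> {0, 1}) \<and> (\<forall>i\<ge>m. X i = 0)
    \<and> (\<forall>k. \<eta> * half_autoconv X k \<le> \<eta> * half_autoconv p k + (ln (2 * real m + 1) + \<eta>\<^sup>2 * m))
    \<and> \<eta> * (\<Sum>i<m. p i) \<le> \<eta> * (\<Sum>i<m. X i) + (ln (2 * real m + 1) + \<eta>\<^sup>2 * m)"
    by (rule exists_thinning_exp) (use p supp \<eta> in auto)
  then obtain X :: "nat \<Rightarrow> real" where X: "\<forall>i. X i \<in> {0, 1}" "\<forall>i\<ge>m. X i = 0"
      and h: "\<forall>k. \<eta> * half_autoconv X k \<le> \<eta> * half_autoconv p k + (ln (2 * real m + 1) + \<eta>\<^sup>2 * m)"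
      and s: "\<eta> * (\<Sum>i<m. p i) \<le> \<eta> * (\<Sum>i<m. X i) + (ln (2 * real m + 1) + \<eta>\<^sup>2 * m)"
    by (elim exE conjE) (rule that)
  have cancel: "x \<le> y + 2 * \<eta> * m" if "\<eta> * x \<le> \<eta> * y + (ln (2 * real m + 1) + \<eta>\<^sup>2 * m)" for x y
  proof -
    have "\<eta> * x \<le> \<eta> * (y + 2 * \<eta> * m)" using that m by (simp add: algebra_simps power2_eq_square)
    then show ?thesis using \<eta> by simp
  qed
  have "autoconv X k \<le> autoconv p k + 4 * \<eta> * m + 1" for k
  proof -
    have "half_autoconv X k \<le> half_autoconv p k + 2 * \<eta> * m" using h cancel by blast
    moreover have "(if even k then (X (k div 2))\<^sup>2 else 0) \<le> 1"
      using X(1)[rule_format, of "k div 2"] by auto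
    moreover have "0 \<le> (if even k then (p (k div 2))\<^sup>2 else 0)" by simp
    ultimately show ?thesis unfolding autoconv_eq_half_autoconv[of _ k] by linarith
  qed
  moreover have "(\<Sum>i<m. p i) - 2 * \<eta> * m \<le> (\<Sum>i<m. X i)" using cancel[OF s] by simp
  ultimately show ?thesis using X by blast
qed

section \<open>From step functions to sets\<close>

lemma unit_lmeasurable: "A \<in> sets lebesgue \<Longrightarrow> A \<subseteq> {0..<1::real} \<Longrightarrow> A \<in> lmeasurable"
  by (rule bounded_set_imp_lmeasurable) (auto intro: bounded_subset[of "{0..<1::real}"])

lemma exists_between_measure:
  fixes E F :: "real set"
  assumes E: "E \<in> sets lebesgue" and F: "F \<in> sets lebesgue" "E \<subseteq> F" "F \<subseteq> {0..<1}"
    and \<epsilon>: "measure lebesgue E \<le> \<epsilon>" "\<epsilon> \<le> measure lebesgue F"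
  shows "\<exists>B. E \<subseteq> B \<and> B \<subseteq> F \<and> B \<in> sets lebesgue \<and> measure lebesgue B = \<epsilon>"
proof -
  define B where "B t = E \<union> (F \<inter> {..<t})" for t
  have meas: "B t \<in> sets lebesgue" for t unfolding B_def using E F(1) by (intro sets.Un sets.Int) auto
  have sub: "E \<subseteq> B t" "B t \<subseteq> F" for t unfolding B_def using F(2) by auto
  have lm: "B t \<in> lmeasurable" for t using meas sub(2) F(3) by (intro unit_lmeasurable) auto
  have mono: "measure lebesgue (B s) \<le> measure lebesgue (B t)" if "s \<le> t" for s t
    using lm meas that by (intro measure_mono_fmeasurable) (auto simp: B_def)
  have step: "measure lebesgue (B t) \<le> measure lebesgue (B s) + (t - s)" if "s \<le> t" for s t
  proof -
    have "measure lebesgue (B t) \<le> measure lebesgue (B s \<union> {s..t})"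
      using lm meas by (intro measure_mono_fmeasurable fmeasurable.Un) (auto simp: B_def)
    also have "\<dots> \<le> measure lebesgue (B s) + measure lebesgue {s..t}"
      using meas by (intro measure_Un_le) auto
    also have "measure lebesgue {s..t} = t - s" using that by simp
    finally show ?thesis .
  qed
  have "1-lipschitz_on {0..1} (\<lambda>t. measure lebesgue (B t))"
  proof (rule lipschitz_onI)
    fix s t :: real
    show "dist (measure lebesgue (B s)) (measure lebesgue (B t)) \<le> 1 * dist s t"
      using mono[of s t] mono[of t s] step[of s t] step[of t s]
      by (cases "s \<le> t") (auto simp: dist_real_def)
  qed simp
  then have "continuous_on {0..1} (\<lambda>t. measure lebesgue (B t))"
    by (rule lipschitz_on_continuous_on)
  moreover have "B 0 = E" "B 1 = F" unfolding B_def using F(2,3) by force+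
  ultimately obtain t where "measure lebesgue (B t) = \<epsilon>"
    using IVT'[of "\<lambda>t. measure lebesgue (B t)" 0 \<epsilon> 1] \<epsilon> by auto
  then show ?thesis using sub meas by (intro exI[of _ "B t"]) simp
qed

text \<open>
  Adding or removing points adjusts the measure of \<open>A\<close> to \<open>\<epsilon>\<close>. Each added point enters a
  reflected overlap at most twice, once by itself and once as the reflection of a point.
\<close>
lemma Delta_le_of_set:
  assumes A: "A \<in> sets lebesgue" "A \<subseteq> {0..<1}"
    and \<epsilon>: "0 \<le> \<epsilon>" "\<epsilon> \<le> 1" "\<epsilon> - measure lebesgue A \<le> \<delta>" "0 \<le> \<delta>"
    and M: "\<And>c. measure lebesgue (A \<inter> reflect c A) \<le> M"
  shows "Delta \<epsilon> \<le> M + 2 * \<delta>"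
proof -
  have M0: "0 \<le> M" using M[of 0] measure_nonneg order_trans by blast
  have lmA: "A \<in> lmeasurable" using A by (rule unit_lmeasurable)
  obtain B where B: "B \<in> sets lebesgue" "B \<subseteq> {0..<1}" "measure lebesgue B = \<epsilon>"
    and dB: "measure lebesgue (B - A) \<le> \<delta>"
  proof (cases "measure lebesgue A \<le> \<epsilon>")
    case True
    have "measure lebesgue {0..<1::real} = 1" by simp
    then obtain B where B: "A \<subseteq> B" "B \<subseteq> {0..<1}" "B \<in> sets lebesgue" "measure lebesgue B = \<epsilon>"
      using exists_between_measure[of A "{0..<1}" \<epsilon>] A True \<epsilon> by auto
    have "measure lebesgue (B - A) = measure lebesgue B - measure lebesgue A"
      using B A by (intro measurable_measure_Diff unit_lmeasurable) auto
    then show ?thesis using that B \<epsilon> by auto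
  next
    case False
    then obtain B where "B \<subseteq> A" "B \<in> sets lebesgue" "measure lebesgue B = \<epsilon>"
      using exists_between_measure[of "{}" A \<epsilon>] A \<epsilon> by auto
    moreover from this have "B - A = {}" by auto
    ultimately show ?thesis using that[of B] A(2) \<epsilon>(4) by (metis measure_empty order_trans)
  qed
  have lmB: "B \<in> lmeasurable" using B by (intro unit_lmeasurable)
  have lmD: "B - A \<in> lmeasurable" using B A by (intro unit_lmeasurable) auto
  have "emeasure lebesgue (B \<inter> reflect c B) \<le> ennreal (M + 2 * \<delta>)" for c
  proof -
    have "emeasure lebesgue (B \<inter> reflect c B)
        \<le> emeasure lebesgue (A \<inter> reflect c A \<union> (B - A \<union> reflect c (B - A)))"
      using A B by (intro emeasure_mono) auto
    also have "\<dots> \<le> emeasure lebesgue (A \<inter> reflect c A)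
        + (emeasure lebesgue (B - A) + emeasure lebesgue (reflect c (B - A)))"
      using A B by (intro order_trans[OF emeasure_subadditive] add_left_mono) auto
    also have "emeasure lebesgue (A \<inter> reflect c A) \<le> ennreal M"
      using M lmA A by (subst emeasure_eq_measure2) (auto simp: fmeasurable_Int_fmeasurable ennreal_leI)
    also have "emeasure lebesgue (reflect c (B - A)) = emeasure lebesgue (B - A)"
      using A B by (intro emeasure_reflect) auto
    also have "emeasure lebesgue (B - A) \<le> ennreal \<delta>"
      using dB lmD by (subst emeasure_eq_measure2) (auto simp: ennreal_leI)
    finally show ?thesis
      using M0 \<epsilon>(4) by (simp add: ennreal_plus[symmetric] add_mono del: ennreal_plus)
  qed
  then have "D B \<le> ennreal (M + 2 * \<delta>)"
    unfolding D_eq_SUP_reflect[OF B(1)] by (intro SUP_least)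
  moreover have "ennreal (Delta \<epsilon>) \<le> D B"
    unfolding ennreal_Delta[OF \<epsilon>(1,2)] using B lmB
    by (intro Inf_lower CollectI exI[of _ B]) (auto simp: emeasure_eq_measure2)
  ultimately have "ennreal (Delta \<epsilon>) \<le> ennreal (M + 2 * \<delta>)" by (rule order_trans[rotated])
  then show ?thesis using M0 \<epsilon>(4) by (simp add: ennreal_le_iff del: ennreal_plus)
qed

definition cells :: "nat \<Rightarrow> nat set \<Rightarrow> real set" where
  "cells m S = (\<Union>i\<in>S. {real i / m..<real (Suc i) / m})"

lemma in_cells: "m > 0 \<Longrightarrow> x \<in> cells m S \<longleftrightarrow> (\<exists>i\<in>S. real i \<le> m * x \<and> m * x < real i + 1)"
  by (auto simp: cells_def field_simps)

lemma cells_sets [simp]: "cells m S \<in> sets lebesgue"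
  unfolding cells_def by auto

lemma cells_subset: "S \<subseteq> {..<m} \<Longrightarrow> cells m S \<subseteq> {0..<1}"
proof
  fix x assume S: "S \<subseteq> {..<m}" and x: "x \<in> cells m S"
  then obtain i where i: "i \<in> S" "x \<in> {real i / m..<real (Suc i) / m}" by (auto simp: cells_def)
  then have "real (Suc i) / m \<le> 1" using S by (auto simp: field_simps)
  moreover have "0 \<le> real i / m" by simp
  ultimately show "x \<in> {0..<1}"
    using i(2) unfolding atLeastLessThan_iff by linarith
qed

lemma measure_cells:
  assumes S: "S \<subseteq> {..<m}"
  shows "measure lebesgue (cells m S) = card S / m"
proof (cases "m = 0")
  case True then show ?thesis using S by (auto simp: cells_def)
next
  case False
  have "disjoint_family_on (\<lambda>i. {real i / m..<real (Suc i) / m}) S"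
    unfolding disjoint_family_on_def
  proof (intro ballI impI)
    fix i j :: nat assume "i \<noteq> j"
    then consider "Suc i \<le> j" | "Suc j \<le> i" by linarith
    then show "{real i / m..<real (Suc i) / m} \<inter> {real j / m..<real (Suc j) / m} = {}"
    proof cases
      case 1
      then have "real (Suc i) / m \<le> real j / m" by (intro divide_right_mono) auto
      then show ?thesis by auto
    next
      case 2
      then have "real (Suc j) / m \<le> real i / m" by (intro divide_right_mono) auto
      then show ?thesis by auto
    qed
  qed
  then have "measure lebesgue (cells m S) = (\<Sum>i\<in>S. measure lebesgue {real i / m..<real (Suc i) / m})"
    unfolding cells_def using finite_subset[OF S]
    by (intro measure_finite_Union) (auto simp: divide_right_mono)
  also have "\<dots> = (\<Sum>i\<in>S. 1 / m)"
    by (intro sum.cong refl) (simp add: divide_right_mono diff_divide_distrib[symmetric])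
  finally show ?thesis by simp
qed

lemma autoconv_of_bool: "autoconv (\<lambda>i. of_bool (i \<in> S)) k = card {i. i \<le> k \<and> i \<in> S \<and> k - i \<in> S}"
proof -
  have "autoconv (\<lambda>i. of_bool (i \<in> S)) k = (\<Sum>i\<le>k. of_bool (i \<in> S \<and> k - i \<in> S))"
    unfolding autoconv_def by (intro sum.cong) auto
  also have "\<dots> = card ({..k} \<inter> {i. i \<in> S \<and> k - i \<in> S})"
    by (subst sum_of_bool_eq) auto
  also have "{..k} \<inter> {i. i \<in> S \<and> k - i \<in> S} = {i. i \<le> k \<and> i \<in> S \<and> k - i \<in> S}" by auto
  finally show ?thesis .
qed

text \<open>
  As a function of \<open>c\<close> the overlap interpolates linearly between its values at multiples of
  \<open>1 / m\<close>, which are values of the autoconvolution divided by \<open>m\<close>. With \<open>m * c = k + \<theta>\<close> and \<open>x\<close> in cell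
  \<open>i\<close>, the reflected point \<open>c - x\<close> is in cell \<open>k - i\<close> or in cell \<open>k - i - 1\<close>, according to
  whether \<open>x\<close> is in the first \<open>\<theta>\<close> part of its cell.
\<close>
lemma measure_cells_Int_reflect_le:
  assumes S: "S \<subseteq> {..<m}" and R: "\<And>k. autoconv (\<lambda>i. of_bool (i \<in> S)) k \<le> R"
  shows "measure lebesgue (cells m S \<inter> reflect c (cells m S)) \<le> R / m"
proof -
  define A where "A = cells m S"
  have R0: "0 \<le> R" using R[of 0] unfolding autoconv_of_bool by (meson of_nat_0_le_iff order_trans)
  have A0: "A \<subseteq> {0..<1}" unfolding A_def using S by (rule cells_subset)
  show ?thesis
  proof (cases "0 \<le> c \<and> m > 0")
    case False
    have "A \<inter> reflect c A = {}"
    proof (cases "m > 0")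
      case True
      then have "c < 0" using False by simp
      then have "x \<notin> A \<or> c - x \<notin> A" for x using A0 by (cases "0 \<le> x") force+
      then show ?thesis by auto
    next
      case False
      then show ?thesis using S by (simp add: A_def cells_def)
    qed
    then have "measure lebesgue (A \<inter> reflect c A) = 0" by simp
    then show ?thesis using R0 by (simp add: A_def)
  next
    case True
    then have m: "m > 0" by simp
    define k \<theta> where "k = nat \<lfloor>m * c\<rfloor>" and "\<theta> = m * c - k"
    have \<theta>: "0 \<le> \<theta>" "\<theta> < 1" and k: "m * c = k + \<theta>"
      using True by (auto simp: k_def \<theta>_def of_nat_nat) linarith
    define K where "K = {i. i \<le> k \<and> i \<in> S \<and> k - i \<in> S}"
    define L where "L = {i. Suc i \<le> k \<and> i \<in> S \<and> k - Suc i \<in> S}"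
    have fin: "finite K" "finite L"
      unfolding K_def L_def by (rule finite_subset[of _ "{..k}"]; auto)+
    have K: "card K \<le> R" using R[of k] by (simp add: autoconv_of_bool K_def)
    have L: "card L \<le> R"
    proof (cases "k = 0")
      case True then show ?thesis using R0 by (simp add: L_def)
    next
      case False
      then have "L = {i. i \<le> k - 1 \<and> i \<in> S \<and> (k - 1) - i \<in> S}" by (auto simp: L_def)
      then show ?thesis using R[of "k - 1"] by (simp add: autoconv_of_bool)
    qed
    let ?P = "\<lambda>i. {real i / m..(real i + \<theta>) / m}" and ?Q = "\<lambda>i. {(real i + \<theta>) / m..(real i + 1) / m}"
    have "A \<inter> reflect c A \<subseteq> (\<Union>i\<in>K. ?P i) \<union> (\<Union>i\<in>L. ?Q i)"
    proof
      fix x assume "x \<in> A \<inter> reflect c A"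
      then obtain i j where i: "i \<in> S" "real i \<le> m * x" "m * x < real i + 1"
        and j: "j \<in> S" "real j \<le> m * (c - x)" "m * (c - x) < real j + 1"
        unfolding A_def using in_cells[OF m] by auto
      have mx: "m * (c - x) = k + \<theta> - m * x" using k by (simp add: algebra_simps)
      show "x \<in> (\<Union>i\<in>K. ?P i) \<union> (\<Union>i\<in>L. ?Q i)"
      proof (cases "m * x \<le> i + \<theta>")
        case True
        then have "real (i + j) < real k + 1" "real k < real (i + j) + 1"
          using i j mx \<theta> by auto
        then have "i + j = k" by linarith
        then have "i \<in> K" using i j by (auto simp: K_def)
        moreover have "x \<in> ?P i" using i True m by (simp add: field_simps)
        ultimately show ?thesis by blast
      next
        case False
        then have "real (i + j) < real k" "real k < real (i + j) + 2"
          using i j mx \<theta> by auto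
        then have "Suc i + j = k" by linarith
        then have "i \<in> L" using i j by (auto simp: L_def)
        moreover have "x \<in> ?Q i" using i False m by (simp add: field_simps)
        ultimately show ?thesis by blast
      qed
    qed
    then have "measure lebesgue (A \<inter> reflect c A) \<le> measure lebesgue ((\<Union>i\<in>K. ?P i) \<union> (\<Union>i\<in>L. ?Q i))"
      using fin by (intro measure_mono_fmeasurable fmeasurable.Un fmeasurable.finite_UN)
        (auto simp: A_def intro!: lmeasurable_compact)
    also have "\<dots> \<le> measure lebesgue (\<Union>i\<in>K. ?P i) + measure lebesgue (\<Union>i\<in>L. ?Q i)"
      using fin by (intro measure_Un_le sets.finite_UN) auto
    also have "\<dots> \<le> (\<Sum>i\<in>K. measure lebesgue (?P i)) + (\<Sum>i\<in>L. measure lebesgue (?Q i))"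
      using fin by (intro add_mono measure_UNION_le) auto
    also have "(\<Sum>i\<in>K. measure lebesgue (?P i)) = (\<Sum>i\<in>K. \<theta> / m)"
      using \<theta> m by (intro sum.cong refl) (simp add: divide_right_mono add_divide_distrib)
    also have "(\<Sum>i\<in>L. measure lebesgue (?Q i)) = (\<Sum>i\<in>L. (1 - \<theta>) / m)"
      using \<theta> m by (intro sum.cong refl) (simp add: divide_right_mono diff_divide_distrib[symmetric])
    also have "(\<Sum>i\<in>K. \<theta> / m) + (\<Sum>i\<in>L. (1 - \<theta>) / m) = (card K * \<theta> + card L * (1 - \<theta>)) / m"
      by (simp add: add_divide_distrib)
    also have "\<dots> \<le> (R * \<theta> + R * (1 - \<theta>)) / m"
      using K L \<theta> by (intro divide_right_mono add_mono mult_right_mono) auto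
    also have "\<dots> = R / m" by (simp add: algebra_simps)
    finally show ?thesis by (simp add: A_def)
  qed
qed

text \<open>
  The density with value \<open>p i\<close> on the cell \<open>i\<close> of \<open>n\<close> has an autoconvolution at most \<open>M\<close> and
  integral at least \<open>\<epsilon> - \<delta>\<close>. Refining every cell into \<open>N\<close> parts changes neither, and rounding on
  the refined cells costs an error that tends to 0 with \<open>N\<close>.
\<close>
lemma Delta_step_le:
  fixes p :: "nat \<Rightarrow> real" and M \<delta> \<epsilon> :: real
  assumes n: "n > 0" and p: "\<And>i. p i \<in> {0..1}" and supp: "\<And>i. n \<le> i \<Longrightarrow> p i = 0"
    and M: "\<And>k. autoconv p k \<le> n * M" "0 \<le> M"
    and \<epsilon>: "0 \<le> \<epsilon>" "\<epsilon> \<le> 1" "n * \<epsilon> \<le> (\<Sum>i<n. p i) + n * \<delta>" "0 \<le> \<delta>"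
  shows "Delta \<epsilon> \<le> M + 2 * \<delta>"
proof (rule field_le_epsilon)
  fix e :: real assume e: "0 < e"
  \<comment> \<open>Rounding costs \<open>5 * \<eta>\<close> in the overlaps and \<open>2 * \<eta>\<close> in the measure, which counts twice.\<close>
  define \<eta> where "\<eta> = min 1 (e / 9)"
  have \<eta>: "0 < \<eta>" "\<eta> \<le> 1" "9 * \<eta> \<le> e"
    using e unfolding \<eta>_def by (simp_all add: min_def)
  \<comment> \<open>This makes \<open>2 * sqrt (3 * m)\<close>, a bound for the logarithm, at most \<open>\<eta>\<^sup>2 * m\<close>.\<close>
  obtain N :: nat where N: "12 / \<eta> ^ 4 < N"
    using reals_Archimedean2 by blast
  moreover have "0 \<le> 12 / \<eta> ^ 4" by simp
  ultimately have N0: "N > 0" by (metis le_less_trans of_nat_0_less_iff)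
  define m where "m = n * N"
  define q where "q i = p (i div N)" for i
  have m: "m > 0" using n N0 by (simp add: m_def)
  have m_large: "12 \<le> \<eta> ^ 4 * m"
  proof -
    have "real N * 1 \<le> real N * real n" using n by (intro mult_left_mono) auto
    then have "12 / \<eta> ^ 4 \<le> m" using N by (simp add: m_def mult.commute)
    then show ?thesis using \<eta>(1) by (simp add: field_simps)
  qed
  have small: "ln (2 * real m + 1) \<le> \<eta>\<^sup>2 * m"
  proof -
    have "ln (2 * real m + 1) = 2 * ln (sqrt (2 * real m + 1))" by (simp add: ln_sqrt)
    also have "\<dots> \<le> 2 * sqrt (2 * real m + 1)"
      using ln_bound[of "sqrt (2 * real m + 1)"] by simp
    also have "\<dots> = sqrt (4 * (2 * real m + 1))" by (simp only: real_sqrt_mult real_sqrt_four)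
    also have "\<dots> \<le> \<eta>\<^sup>2 * m"
    proof (rule real_le_lsqrt)
      have "4 * (2 * real m + 1) \<le> 12 * real m" using m by simp
      also have "\<dots> \<le> (\<eta> ^ 4 * m) * m" using m_large by (intro mult_right_mono) auto
      also have "\<dots> = (\<eta>\<^sup>2 * m)\<^sup>2" by (simp add: power2_eq_square power4_eq_xxxx)
      finally show "4 * (2 * real m + 1) \<le> (\<eta>\<^sup>2 * m)\<^sup>2" .
    qed (use \<eta> in auto)
    finally show ?thesis .
  qed
  have one: "1 \<le> \<eta> * m"
  proof -
    have "\<eta> ^ 4 * m \<le> \<eta> ^ 1 * m"
      using \<eta> by (intro mult_right_mono power_decreasing) auto
    then show ?thesis using m_large by simp
  qed
  have "\<exists>X::nat \<Rightarrow> real. (\<forall>i. X i \<in> {0, 1}) \<and> (\<forall>i\<ge>m. X i = 0)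
    \<and> (\<forall>k. autoconv X k \<le> autoconv q k + 4 * \<eta> * m + 1)
    \<and> (\<Sum>i<m. q i) - 2 * \<eta> * m \<le> (\<Sum>i<m. X i)"
  proof (rule exists_thinning)
    fix i show "q i \<in> {0..1}" using p by (simp add: q_def)
  next
    fix i assume "m \<le> i"
    then have "n \<le> i div N" using N0 by (simp add: m_def less_eq_div_iff_mult_less_eq)
    then show "q i = 0" using supp by (simp add: q_def)
  qed (use \<eta> small in auto)
  then obtain X :: "nat \<Rightarrow> real" where X: "\<forall>i. X i \<in> {0, 1}" "\<forall>i\<ge>m. X i = 0"
    and cX: "\<And>k. autoconv X k \<le> autoconv q k + 4 * \<eta> * m + 1"
    and sX: "(\<Sum>i<m. q i) - 2 * \<eta> * m \<le> (\<Sum>i<m. X i)"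
    by blast
  define S where "S = {i. X i = 1}"
  have XS: "X = (\<lambda>i. of_bool (i \<in> S))" using X(1) by (auto simp: S_def fun_eq_iff)
  have S: "S \<subseteq> {..<m}" using X(2) by (auto simp: S_def) (metis not_le zero_neq_one)
  have "autoconv X k \<le> m * (M + 5 * \<eta>)" for k
  proof -
    have "autoconv q k \<le> real N * (real n * M)"
      unfolding q_def using N0 M n by (intro autoconv_refine_le) auto
    then show ?thesis using cX[of k] one by (simp add: m_def algebra_simps)
  qed
  then have "measure lebesgue (cells m S \<inter> reflect c (cells m S)) \<le> m * (M + 5 * \<eta>) / m" for c
    unfolding XS using S by (intro measure_cells_Int_reflect_le)
  then have overlap: "measure lebesgue (cells m S \<inter> reflect c (cells m S)) \<le> M + 5 * \<eta>" for c
    using m by simp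
  have sumq: "(\<Sum>i<m. q i) = N * (\<Sum>i<n. p i)"
  proof -
    have "(\<Sum>i<m. q i) = (\<Sum>a<n. \<Sum>i\<in>{a * N..<a * N + N}. q i)"
      unfolding m_def by (rule sum.nat_group[symmetric])
    also have "\<dots> = (\<Sum>a<n. \<Sum>i\<in>{a * N..<a * N + N}. p a)"
    proof (rule sum.cong[OF refl], rule sum.cong[OF refl])
      fix a i assume "i \<in> {a * N..<a * N + N}"
      then have "i div N = a" by (intro div_nat_eqI) (auto simp: algebra_simps)
      then show "q i = p a" by (simp add: q_def)
    qed
    finally show ?thesis by (simp add: sum_distrib_left)
  qed
  have "(\<Sum>i<m. X i) = card S"
  proof -
    have "(\<Sum>i<m. X i) = card ({..<m} \<inter> S)" unfolding XS by (subst sum_of_bool_eq) auto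
    then show ?thesis using S by (simp add: Int_absorb1)
  qed
  then have "m * \<epsilon> \<le> card S + m * (\<delta> + 2 * \<eta>)"
    using sX sumq mult_left_mono[OF \<epsilon>(3), of N] by (simp add: m_def algebra_simps)
  then have "\<epsilon> - measure lebesgue (cells m S) \<le> \<delta> + 2 * \<eta>"
    using m by (simp add: measure_cells[OF S] field_simps)
  then have "Delta \<epsilon> \<le> (M + 5 * \<eta>) + 2 * (\<delta> + 2 * \<eta>)"
    using overlap \<epsilon> \<eta> by (intro Delta_le_of_set[of "cells m S"] cells_subset S) auto
  also have "\<dots> = M + 2 * \<delta> + 9 * \<eta>" by simp
  also have "\<dots> \<le> M + 2 * \<delta> + e" using \<eta>(3) by (rule add_left_mono)
  finally show "Delta \<epsilon> \<le> M + 2 * \<delta> + e" .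
qed

section \<open>A step function on eighths\<close>

definition eighths :: "nat \<Rightarrow> real" where
  "eighths i = (if i \<in> {0, 1, 2, 4, 7} then 1 else if i = 5 then 1 / 2 else 0)"

text \<open>
  The largest value 3 is attained, among others, at \<open>k = 7\<close>. There the value is
  \<open>8 (2 \<cdot> 11/16 - 1)\<close>, the least possible for this sum, since in each pair \<open>i, 7 - i\<close> one of the
  two entries is 1.
\<close>
lemma autoconv_eighths_le: "autoconv eighths k \<le> 3"
proof (cases "k < 15")
  case True
  have "\<forall>k<15. autoconv eighths k \<le> 3"
    by (simp add: All_less_Suc numeral_eq_Suc autoconv_def eighths_def)
  then show ?thesis using True by blast
next
  case False
  have zero: "eighths i * eighths (k - i) = 0" for i
    using False by (auto simp: eighths_def)
  show ?thesis unfolding autoconv_def zero by simp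
qed

lemma sum_eighths: "(\<Sum>i<8. eighths i) = 11 / 2"
  by (simp add: eighths_def numeral_eq_Suc)

lemma Delta_le_eighths:
  assumes t: "0 \<le> t" "t \<le> 1" and \<epsilon>: "\<epsilon> \<le> 1" "\<epsilon> = 11 / 16 * t + \<delta>" "0 \<le> \<delta>"
  shows "Delta \<epsilon> \<le> 3 / 8 * t\<^sup>2 + 2 * \<delta>"
proof (rule Delta_step_le[where n = 8 and p = "\<lambda>i. t * eighths i"])
  show "t * eighths i \<in> {0..1}" for i
    using t by (auto simp: eighths_def)
  show "t * eighths i = 0" if "8 \<le> i" for i
    using that by (auto simp: eighths_def)
  show "autoconv (\<lambda>i. t * eighths i) k \<le> real 8 * (3 / 8 * t\<^sup>2)" for k
  proof -
    have "autoconv (\<lambda>i. t * eighths i) k = t\<^sup>2 * autoconv eighths k"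
      by (simp add: autoconv_def sum_distrib_left power2_eq_square ac_simps)
    also have "\<dots> \<le> t\<^sup>2 * 3" using autoconv_eighths_le by (intro mult_left_mono) auto
    finally show ?thesis by simp
  qed
  show "real 8 * \<epsilon> \<le> (\<Sum>i<8. t * eighths i) + real 8 * \<delta>"
    using \<epsilon> by (simp add: sum_distrib_left[symmetric] sum_eighths)
qed (use t \<epsilon> in auto)

section \<open>The truncated inverse square root\<close>

text \<open>
  The sum is a lower Riemann sum of \<open>1 / sqrt (x (c - x))\<close> over \<open>[0, c]\<close> with \<open>c = k + 1\<close>,
  each of the two factors being estimated from below on its cell. An antiderivative is
  \<open>arcsin (2 x / c - 1)\<close>, which runs from \<open>- \<pi> / 2\<close> to \<open>\<pi> / 2\<close>.
\<close>
lemma sum_inverse_sqrt_le_pi: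
  "(\<Sum>i\<le>k. 1 / sqrt ((real i + 1) * (real (k - i) + 1))) \<le> pi"
proof -
  define c where "c = real k + 1"
  define \<phi> where "\<phi> x = arcsin (2 * x / c - 1)" for x
  have c: "c > 0" by (simp add: c_def)
  have step: "1 / sqrt ((real i + 1) * (real (k - i) + 1)) \<le> \<phi> (real (Suc i)) - \<phi> (real i)"
    if "i \<le> k" for i
  proof -
    have ic: "real i + 1 \<le> c" using that by (simp add: c_def)
    have range: "- 1 \<le> 2 * x / c - 1" "2 * x / c - 1 \<le> 1" if "0 \<le> x" "x \<le> c" for x
      using that c by (auto simp: field_simps)
    have "continuous_on {real i..real i + 1} \<phi>"
      unfolding \<phi>_def using ic c range by (intro continuous_intros) auto
    moreover have "(\<phi> has_derivative (*) (1 / sqrt (x * (c - x)))) (at x)"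
      if x: "real i < x" "x < real i + 1" for x
    proof -
      have x0: "0 < x" "x < c" using x ic by auto
      have "1 - (2 * x / c - 1)\<^sup>2 = x * (c - x) * (2 / c)\<^sup>2"
        using c by (simp add: field_simps power2_eq_square)
      then have "sqrt (1 - (2 * x / c - 1)\<^sup>2) = sqrt (x * (c - x)) * (2 / c)"
        using c by (simp add: real_sqrt_mult)
      moreover have "(\<phi> has_real_derivative inverse (sqrt (1 - (2 * x / c - 1)\<^sup>2)) * (2 / c)) (at x)"
        unfolding \<phi>_def using x0 c
        by (auto intro!: derivative_eq_intros simp: field_simps)
      ultimately have "(\<phi> has_real_derivative 1 / sqrt (x * (c - x))) (at x)"
        using c by (simp add: field_simps)
      then show ?thesis by (simp add: has_field_derivative_def)
    qed
    ultimately obtain \<xi> where \<xi>: "real i < \<xi>" "\<xi> < real i + 1"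
      and mvt: "\<phi> (real i + 1) - \<phi> (real i) = 1 / sqrt (\<xi> * (c - \<xi>)) * (real i + 1 - real i)"
      using mvt[of "real i" "real i + 1" \<phi> "\<lambda>x. (*) (1 / sqrt (x * (c - x)))"] by auto
    have "\<xi> * (c - \<xi>) \<le> (real i + 1) * (real (k - i) + 1)"
      using \<xi> that by (intro mult_mono) (auto simp: c_def of_nat_diff)
    moreover have "0 < \<xi> * (c - \<xi>)" using \<xi> ic by (intro mult_pos_pos) auto
    ultimately have "1 / sqrt ((real i + 1) * (real (k - i) + 1)) \<le> 1 / sqrt (\<xi> * (c - \<xi>))"
      by (intro divide_left_mono) auto
    then show ?thesis using mvt by (simp add: add.commute)
  qed
  have "(\<Sum>i\<le>k. 1 / sqrt ((real i + 1) * (real (k - i) + 1)))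
      \<le> (\<Sum>i\<le>k. \<phi> (real (Suc i)) - \<phi> (real i))"
    using step by (intro sum_mono) auto
  also have "\<dots> = \<phi> c - \<phi> 0"
    using sum_lessThan_telescope[of "\<lambda>i. \<phi> (real i)" "Suc k"]
    by (simp add: lessThan_Suc_atMost c_def add.commute)
  also have "\<dots> = pi" using c by (simp add: \<phi>_def)
  finally show ?thesis .
qed

text \<open>
  The function \<open>\<Psi>\<close> is the antiderivative of the decreasing density \<open>min 1 (b / sqrt u)\<close>, so it
  is concave and its increments are at most those of the tangent at the left end.
\<close>
lemma truncated_sqrt_increment_le:
  fixes b x y :: real
  assumes b: "0 \<le> b" and xy: "0 < x" "x \<le> y"
  defines "\<Psi> \<equiv> \<lambda>u. if u \<le> b\<^sup>2 then u else 2 * b * sqrt u - b\<^sup>2"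
  shows "\<Psi> y - \<Psi> x \<le> (y - x) * min 1 (b / sqrt x)"
proof -
  have s: "0 < sqrt x" "sqrt x \<le> sqrt y" "(sqrt x)\<^sup>2 = x" "(sqrt y)\<^sup>2 = y" using xy by auto
  have below: "2 * b * sqrt u - b\<^sup>2 \<le> u" if "0 \<le> u" for u
  proof -
    have "0 \<le> (sqrt u - b)\<^sup>2" by simp
    then show ?thesis using that by (simp add: power2_eq_square algebra_simps)
  qed
  show ?thesis
  proof (cases "x \<le> b\<^sup>2")
    case True
    then have "sqrt x \<le> b" using b by (intro real_le_lsqrt)
    then have "1 \<le> b / sqrt x" using s by simp
    then have "min 1 (b / sqrt x) = 1" by simp
    then show ?thesis using True below[of y] xy by (auto simp: \<Psi>_def)
  next
    case False
    then have bx: "b < sqrt x" using b by (simp add: real_less_rsqrt)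
    then have "b / sqrt x \<le> 1" using s by simp
    then have min: "min 1 (b / sqrt x) = b / sqrt x" by simp
    have "y - x = (sqrt y - sqrt x) * (sqrt y + sqrt x)"
      using s by (simp add: algebra_simps power2_eq_square)
    also have "\<dots> \<ge> (sqrt y - sqrt x) * (2 * sqrt x)"
      using s by (intro mult_left_mono) auto
    finally have "2 * (sqrt y - sqrt x) * sqrt x \<le> y - x" by (simp add: algebra_simps)
    then have "2 * (sqrt y - sqrt x) * sqrt x * (b / sqrt x) \<le> (y - x) * (b / sqrt x)"
      using b s by (intro mult_right_mono) auto
    moreover have "2 * (sqrt y - sqrt x) * sqrt x * (b / sqrt x) = 2 * b * sqrt y - 2 * b * sqrt x"
      using s by (simp add: algebra_simps)
    ultimately show ?thesis using False xy min by (simp add: \<Psi>_def)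
  qed
qed

text \<open>
  The density is sampled at the right end of each of \<open>m\<close> cells. As it is decreasing, this lowers
  the autoconvolution, and it lowers the integral by at most \<open>1 / m\<close>.
\<close>
lemma Delta_le_pi:
  assumes \<epsilon>: "0 < \<epsilon>" "\<epsilon> \<le> 1"
  shows "Delta \<epsilon> \<le> pi * \<epsilon>\<^sup>2 / (1 + sqrt (1 - \<epsilon>))\<^sup>2"
proof -
  define s where "s = sqrt (1 - \<epsilon>)"
  define b where "b = 1 - s"
  have s: "0 \<le> s" "s < 1" "s\<^sup>2 = 1 - \<epsilon>" using \<epsilon> by (auto simp: s_def)
  have b: "0 < b" "b \<le> 1" using s by (auto simp: b_def)
  have eb: "\<epsilon> = 2 * b - b\<^sup>2" using s(3) by (simp add: b_def power2_eq_square algebra_simps)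
  have es: "\<epsilon> = b * (1 + s)" using s(3) by (simp add: b_def power2_eq_square algebra_simps)
  have "pi * (b * (1 + s))\<^sup>2 / (1 + s)\<^sup>2 = b\<^sup>2 * pi"
    using s(1) by (simp add: power_mult_distrib)
  then have target: "pi * \<epsilon>\<^sup>2 / (1 + sqrt (1 - \<epsilon>))\<^sup>2 = b\<^sup>2 * pi"
    by (simp only: es[symmetric] s_def[symmetric])
  have bound: "Delta \<epsilon> \<le> b\<^sup>2 * pi + 2 * (1 / m)" if m: "m > 0" for m :: nat
  proof (rule Delta_step_le[where n = m])
    define p where "p i = (if i < m then min 1 (b / sqrt (real (Suc i) / m)) else 0)" for i
    show "p i \<in> {0..1}" for i using b by (auto simp: p_def)
    show "p i = 0" if "m \<le> i" for i using that by (simp add: p_def)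
    show "autoconv p k \<le> m * (b\<^sup>2 * pi)" for k
    proof -
      have le: "p i \<le> b * sqrt m / sqrt (real i + 1)" for i
        using b m by (auto simp: p_def real_sqrt_divide add.commute min.coboundedI2)
      have nonneg: "0 \<le> p i" for i using b by (auto simp: p_def)
      have "autoconv p k \<le> (\<Sum>i\<le>k. (b * sqrt m / sqrt (real i + 1)) * (b * sqrt m / sqrt (real (k - i) + 1)))"
        unfolding autoconv_def using b by (intro sum_mono mult_mono le nonneg) auto
      also have "\<dots> = m * b\<^sup>2 * (\<Sum>i\<le>k. 1 / sqrt ((real i + 1) * (real (k - i) + 1)))"
        unfolding sum_distrib_left
        by (intro sum.cong refl) (simp add: real_sqrt_mult power2_eq_square)
      also have "\<dots> \<le> m * b\<^sup>2 * pi"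
        by (intro mult_left_mono sum_inverse_sqrt_le_pi) auto
      finally show ?thesis by (simp add: mult.assoc)
    qed
    define \<Psi> where "\<Psi> u = (if u \<le> b\<^sup>2 then u else 2 * b * sqrt u - b\<^sup>2)" for u
    have step: "\<Psi> (real (Suc (Suc i)) / m) - \<Psi> (real (Suc i) / m) \<le> p i / m" if "i < m" for i
    proof -
      have "\<Psi> (real (Suc (Suc i)) / m) - \<Psi> (real (Suc i) / m)
          \<le> (real (Suc (Suc i)) / m - real (Suc i) / m) * min 1 (b / sqrt (real (Suc i) / m))"
        unfolding \<Psi>_def using b m by (intro truncated_sqrt_increment_le divide_right_mono) auto
      also have "real (Suc (Suc i)) / m - real (Suc i) / m = 1 / m"
        by (simp add: diff_divide_distrib[symmetric])
      finally show ?thesis using that by (simp add: p_def)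
    qed
    have "\<Psi> (real (Suc m) / m) - \<Psi> (1 / m)
        = (\<Sum>i<m. \<Psi> (real (Suc (Suc i)) / m) - \<Psi> (real (Suc i) / m))"
      using sum_lessThan_telescope[of "\<lambda>i. \<Psi> (real (Suc i) / m)" m] by simp
    also have "\<dots> \<le> (\<Sum>i<m. p i) / m"
      unfolding sum_divide_distrib using step by (intro sum_mono) auto
    finally have sum: "\<Psi> (real (Suc m) / m) - \<Psi> (1 / m) \<le> (\<Sum>i<m. p i) / m" .
    have "\<epsilon> \<le> \<Psi> (real (Suc m) / m)"
    proof -
      have y: "1 < real (Suc m) / m" using m by simp
      moreover have "b\<^sup>2 \<le> 1" using b by (simp add: power_le_one)
      moreover have "1 \<le> sqrt (real (Suc m) / m)" using y by (simp only: real_sqrt_ge_1_iff)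
      then have "2 * b * 1 \<le> 2 * b * sqrt (real (Suc m) / m)" using b by (intro mult_left_mono) auto
      ultimately show ?thesis unfolding \<Psi>_def eb by auto
    qed
    moreover have "\<Psi> (1 / m) \<le> 1 / m"
    proof -
      have "0 \<le> (sqrt (1 / m) - b)\<^sup>2" by simp
      then have "2 * b * sqrt (1 / m) - b\<^sup>2 \<le> (sqrt (1 / m))\<^sup>2"
        by (simp only: power2_diff) (simp add: algebra_simps)
      then show ?thesis by (simp add: \<Psi>_def)
    qed
    ultimately have "\<epsilon> \<le> (\<Sum>i<m. p i) / m + 1 / m" using sum by linarith
    then show "m * \<epsilon> \<le> (\<Sum>i<m. p i) + m * (1 / m)" using m by (simp add: field_simps)
  qed (use \<epsilon> m b in auto)
  have "(\<lambda>m. b\<^sup>2 * pi + 2 * (1 / real m)) \<longlonglongrightarrow> b\<^sup>2 * pi + 2 * 0"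
    by (intro tendsto_intros lim_1_over_n)
  then have "Delta \<epsilon> \<le> b\<^sup>2 * pi + 2 * 0"
    using bound by (rule_tac tendsto_lowerbound[where F = sequentially])
      (auto simp: eventually_sequentially intro!: exI[of _ 1])
  then show ?thesis by (simp add: target)
qed

lemma pi_bound_asymptotics:
  "(\<lambda>\<epsilon>::real. pi * \<epsilon>^2 / (1 + sqrt (1 - \<epsilon>))^2 - pi/4 * \<epsilon>^2) \<in> O[at_right 0](\<lambda>\<epsilon>. \<epsilon>^3)"
proof (rule bigoI[where c = pi])
  have "\<forall>\<^sub>F \<epsilon>::real in at_right 0. \<epsilon> \<in> {0<..<1}"
    by (rule eventually_at_right_real) simp
  then show "\<forall>\<^sub>F \<epsilon>::real in at_right 0.
      norm (pi * \<epsilon>^2 / (1 + sqrt (1 - \<epsilon>))^2 - pi/4 * \<epsilon>^2) \<le> pi * norm (\<epsilon>^3)"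
  proof eventually_elim
    fix \<epsilon> :: real assume \<epsilon>: "\<epsilon> \<in> {0<..<1}"
    define s where "s = sqrt (1 - \<epsilon>)"
    \<comment> \<open>The cubic error comes from \<open>4 - (1 + s)\<^sup>2 = (1 - s) (3 + s)\<close> and \<open>1 - s = \<epsilon> / (1 + s)\<close>.\<close>
    have s: "0 \<le> s" "s \<le> 1" "\<epsilon> = (1 - s) * (1 + s)"
      using \<epsilon> by (auto simp: s_def algebra_simps)
    have ne: "1 + s \<noteq> 0" using s by simp
    have "pi * \<epsilon>^2 / (1 + s)^2 - pi/4 * \<epsilon>^2 = pi / 4 * \<epsilon>\<^sup>2 * ((4 - (1 + s)\<^sup>2) / (1 + s)\<^sup>2)"
      using ne by (simp add: field_simps)
    also have "4 - (1 + s)\<^sup>2 = (1 - s) * (3 + s)" by (simp add: power2_eq_square algebra_simps)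
    finally have eq: "pi * \<epsilon>^2 / (1 + s)^2 - pi/4 * \<epsilon>^2
      = pi / 4 * \<epsilon>\<^sup>2 * ((1 - s) * (3 + s) / (1 + s)\<^sup>2)" .
    have "(1 - s) * (3 + s) / (1 + s)\<^sup>2 \<le> (1 - s) * (3 + s) / 1"
      using s by (intro divide_left_mono) (auto simp: one_le_power)
    also have "\<dots> \<le> (1 - s) * (4 * (1 + s))" using s by (simp add: mult_left_mono)
    also have "\<dots> = 4 * \<epsilon>" using s(3) by simp
    finally have "pi / 4 * \<epsilon>\<^sup>2 * ((1 - s) * (3 + s) / (1 + s)\<^sup>2) \<le> pi / 4 * \<epsilon>\<^sup>2 * (4 * \<epsilon>)"
      by (intro mult_left_mono) auto
    also have "\<dots> = pi * \<epsilon> ^ 3" by (simp add: power2_eq_square power3_eq_cube)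
    finally have "pi * \<epsilon>^2 / (1 + s)^2 - pi/4 * \<epsilon>^2 \<le> pi * \<epsilon> ^ 3" unfolding eq .
    moreover have "0 \<le> pi * \<epsilon>^2 / (1 + s)^2 - pi/4 * \<epsilon>^2"
      unfolding eq using s by simp
    ultimately show "norm (pi * \<epsilon>^2 / (1 + sqrt (1 - \<epsilon>))^2 - pi/4 * \<epsilon>^2) \<le> pi * norm (\<epsilon>^3)"
      using \<epsilon> by (simp add: s_def)
  qed
qed

section \<open>Bounds for the extremal function\<close>

theorem theorem1p1:
  shows "(\<forall>\<epsilon>. 11/16 \<le> \<epsilon> \<and> \<epsilon> \<le> 1 \<longrightarrow> Delta \<epsilon> = 2 * \<epsilon> - 1)
     \<and> (\<forall>\<epsilon>. 1/2 \<le> \<epsilon> \<and> \<epsilon> \<le> 11/16 \<longrightarrow> Delta \<epsilon> \<ge> 2 * \<epsilon> - 1)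
     \<and> (\<forall>\<epsilon>. 0 < \<epsilon> \<and> \<epsilon> \<le> 1 \<longrightarrow> Delta \<epsilon> \<ge> 0.591389 * \<epsilon>^2)
     \<and> (\<forall>\<epsilon>. 0 < \<epsilon> \<and> \<epsilon> \<le> 1 \<longrightarrow> Delta \<epsilon> \<ge> 0.5546 * \<epsilon>^2 + 0.088079 * \<epsilon>^3)
     \<and> (\<forall>\<epsilon>. 0 < \<epsilon> \<and> \<epsilon> \<le> 11/16 \<longrightarrow>
            Delta \<epsilon> \<le> 96/121 * \<epsilon>^2 \<and> 96/121 * \<epsilon>^2 < 0.7934 * \<epsilon>^2)
     \<and> (\<forall>\<epsilon>. 0 < \<epsilon> \<and> \<epsilon> \<le> 1 \<longrightarrow> Delta \<epsilon> \<le> pi * \<epsilon>^2 / (1 + sqrt (1 - \<epsilon>))^2)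
     \<and> (\<lambda>\<epsilon>::real. pi * \<epsilon>^2 / (1 + sqrt (1 - \<epsilon>))^2 - pi/4 * \<epsilon>^2) \<in> O[at_right 0](\<lambda>\<epsilon>. \<epsilon>^3)"
proof (intro conjI allI impI; (elim conjE)?)
  fix \<epsilon> :: real assume \<epsilon>: "11/16 \<le> \<epsilon>" "\<epsilon> \<le> 1"
  have "Delta \<epsilon> \<le> 3 / 8 * 1\<^sup>2 + 2 * (\<epsilon> - 11 / 16)"
    using \<epsilon> by (intro Delta_le_eighths) auto
  then show "Delta \<epsilon> = 2 * \<epsilon> - 1"
    using Delta_ge_two_mult[of \<epsilon>] \<epsilon> by simp
next
  fix \<epsilon> :: real assume "1/2 \<le> \<epsilon>" "\<epsilon> \<le> 11/16"
  then show "Delta \<epsilon> \<ge> 2 * \<epsilon> - 1" by (intro Delta_ge_two_mult) auto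
next
  fix \<epsilon> :: real assume \<epsilon>: "0 < \<epsilon>" "\<epsilon> \<le> 1"
  have "0.591389 * \<epsilon>^2 \<le> 61 / 100 * \<epsilon>\<^sup>2" by (intro mult_right_mono) auto
  then show "Delta \<epsilon> \<ge> 0.591389 * \<epsilon>^2" using Delta_ge_quadratic[OF \<epsilon>] by linarith
next
  fix \<epsilon> :: real assume "0 < \<epsilon>" "\<epsilon> \<le> 1"
  then show "Delta \<epsilon> \<ge> 0.5546 * \<epsilon>^2 + 0.088079 * \<epsilon>^3" by (rule Delta_ge_cubic)
next
  fix \<epsilon> :: real assume \<epsilon>: "0 < \<epsilon>" "\<epsilon> \<le> 11/16"
  have "Delta \<epsilon> \<le> 3 / 8 * (16 / 11 * \<epsilon>)\<^sup>2 + 2 * 0"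
    using \<epsilon> by (intro Delta_le_eighths) auto
  then show "Delta \<epsilon> \<le> 96/121 * \<epsilon>^2" by (simp add: power_mult_distrib power2_eq_square)
  show "96/121 * \<epsilon>^2 < 0.7934 * \<epsilon>^2" using \<epsilon> by (intro mult_strict_right_mono) auto
next
  fix \<epsilon> :: real assume "0 < \<epsilon>" "\<epsilon> \<le> 1"
  then show "Delta \<epsilon> \<le> pi * \<epsilon>^2 / (1 + sqrt (1 - \<epsilon>))^2" by (rule Delta_le_pi)
qed (rule pi_bound_asymptotics)

end
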